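(* Let $C=F+B$ be a plane curve such that $F$ is smooth locally around each point of $F\cap B$. Assume that $F$ is irreducible or $\mathrm{H}_1(F)\simeq\mathbb{Z}$, and that $\mathrm{H}_1(\mathbb{P}^2\setminus B)/\mathrm{Ind}_F$ is a finite group. Then $$\mathrm{lks}(F)=\phi(\mathcal{L}(F,B)),$$ where $\phi:\mathrm{H}_1(\widehat{\mathbb{P}^2}\setminus\hat B)\to\mathrm{H}_1(\mathbb{P}^2\setminus B)/\mathrm{Ind}_F$ is the canonical isomorphism, $\mathrm{lks}(F)$ is the linking set and $\mathcal{L}(F,B)$ is the curves linking of $F$ with $B$.
   Context: Homology is with integer coefficients; $\mathbb{P}^2=\mathbb{CP}^2$. Plane curves are reduced algebraic curves in $\mathbb{P}^2$. Let $C=F+B$ be a plane curve, where $F$ and $B$ are plane curves without common component, such that $F$ is smooth locally around each point $P\in F\cap B$. Admissible blowing-ups: $\sigma:\widehat{\mathbb{P}^2}\to\mathbb{P}^2$ is a finite succession of blowing-ups over $F\cap B$ (at least one over each point of $F\cap B$) such that the strict transform of $C$ intersects the exceptional divisor of $\sigma$ transversally. Let $\tilde F,\tilde B$ be the strict transforms of $F,B$. Enough blowing-ups are performed that $\tilde F\cap\tilde B=\emptyset$ and, over each $P\in F\cap B$, $\tilde F$ meets exactly one irreducible component $D_P$ of $\sigma^{*}(B)$. Let $\sigma^{-1}(B)$ be the set-theoretic preimage, regarded as a reduced divisor, and set $\hat B=\sigma^{-1}(B)-\sum_{P\in F\cap B}D_P$. Then $\tilde F\subset\widehat{\mathbb{P}^2}\setminus\hat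 B$. Curves linking: $\mathcal{L}(F,B)$ is the image of the map $\mathrm{H}_1(\tilde F)\to\mathrm{H}_1(\widehat{\mathbb{P}^2}\setminus\hat B)$ induced by inclusion. $\mathrm{Ind}_F$ and $\phi$: let $\sigma_{B,*}:\mathrm{H}_1(\widehat{\mathbb{P}^2}\setminus\sigma^{-1}(B))\to\mathrm{H}_1(\mathbb{P}^2\setminus B)$ be the isomorphism induced by $\sigma$ and $j_*:\mathrm{H}_1(\widehat{\mathbb{P}^2}\setminus\sigma^{-1}(B))\to\mathrm{H}_1(\widehat{\mathbb{P}^2}\setminus\hat B)$ the (surjective) map induced by inclusion. $\mathrm{Ind}_F$ is the kernel of $j_*\circ\sigma_{B,*}^{-1}$, and $\phi$ is the inverse of the induced isomorphism $\psi:\mathrm{H}_1(\mathbb{P}^2\setminus B)/\mathrm{Ind}_F\to\mathrm{H}_1(\widehat{\mathbb{P}^2}\setminus\hat B)$. Linking set: let $\{g_1,\dots,g_l\}$ be a basis of $\mathrm{H}_1(F)$ represented by cycles contained in $F\setminus B$, and let $\tilde j_*:\mathrm{H}_1(F\setminus B)\to\mathrm{H}_1(\mathbb{P}^2\setminus B)/\mathrm{Ind}_F$ be the map induced by the inclusion $F\setminus B\subset\mathbb{P}^2\setminus B$. For $\gamma$ the image of an embedding of $S^1$ in $F$ which is not homologically trivial in $F$ and avoids $\mathrm{Sing}(C)$, the linking set is $\mathrm{lks}(\gamma)=\tilde j_*(\{\sum_{i=1}^l a_i g_i\mid (a_1,\dots,a_l)\in\mathbb{Z}^l\setminus\{(0,\dots,0)\}\})$.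 When $\mathrm{H}_1(\mathbb{P}^2\setminus B)/\mathrm{Ind}_F$ is finite, this set contains $0$ and does not depend on $\gamma$; it is denoted $$\mathrm{lks}(F)=\tilde j_*\Big(\Big\{\sum_{i=1}^l a_i g_i\ \Big|\ (a_1,\dots,a_l)\in\mathbb{Z}^l\Big\}\Big).$$ *)

theory Defs
  imports
    "HOL-Analysis.Analysis"
    "HOL-Homology.Homology"
    "HOL-Computational_Algebra.Squarefree"
begin

section \<open>Complex surfaces\<close>

definition holomorphic_fun :: "(complex^2 \<Rightarrow> complex) \<Rightarrow> (complex^2) set \<Rightarrow> bool" where
  "holomorphic_fun f W \<longleftrightarrow>
     (\<forall>z\<in>W. \<exists>D. (f has_derivative D) (at z) \<and> Vector_Spaces.linear (*s) (*) D)"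

definition holomorphic_trans :: "(complex^2 \<Rightarrow> complex^2) \<Rightarrow> (complex^2) set \<Rightarrow> bool" where
  "holomorphic_trans f W \<longleftrightarrow> (\<forall>i. holomorphic_fun (\<lambda>z. f z $ i) W)"

type_synonym 'a chart = "'a set \<times> ('a \<Rightarrow> complex^2)"

record 'a csurface =
  stop :: "'a topology"
  satlas :: "'a chart set"

abbreviation pts :: "'a csurface \<Rightarrow> 'a set" where
  "pts S \<equiv> topspace (stop S)"

definition is_chart :: "'a topology \<Rightarrow> 'a chart \<Rightarrow> bool" where
  "is_chart X c \<longleftrightarrow> (case c of (U, \<phi>) \<Rightarrow>
     openin X U \<and> open (\<phi> ` U) \<and>
     homeomorphic_map (subtopology X U) (top_of_set (\<phi> ` U)) \<phi>)"

definition chart_compatible :: "'a chart \<Rightarrow> 'a chart \<Rightarrow> bool" where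
  "chart_compatible c d \<longleftrightarrow> (case c of (U, \<phi>) \<Rightarrow> case d of (V, \<psi>) \<Rightarrow>
     holomorphic_trans (\<psi> \<circ> inv_into U \<phi>) (\<phi> ` (U \<inter> V)) \<and>
     holomorphic_trans (\<phi> \<circ> inv_into V \<psi>) (\<psi> ` (U \<inter> V)))"

definition complex_surface :: "'a csurface \<Rightarrow> bool" where
  "complex_surface S \<longleftrightarrow>
     Hausdorff_space (stop S) \<and> second_countable (stop S) \<and>
     (\<forall>c\<in>satlas S. is_chart (stop S) c) \<and>
     (\<Union>c\<in>satlas S. fst c) = pts S \<and>
     (\<forall>c\<in>satlas S. \<forall>d\<in>satlas S. chart_compatible c d)"

text \<open>The charts of the maximal atlas.\<close>

definition holo_chart :: "'a csurface \<Rightarrow> 'a chart \<Rightarrow> bool" where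
  "holo_chart S c \<longleftrightarrow> is_chart (stop S) c \<and> (\<forall>d\<in>satlas S. chart_compatible c d)"

definition holomorphic_map :: "'a csurface \<Rightarrow> 'b csurface \<Rightarrow> ('a \<Rightarrow> 'b) \<Rightarrow> bool" where
  "holomorphic_map S T f \<longleftrightarrow>
     continuous_map (stop S) (stop T) f \<and>
     (\<forall>(V, \<psi>)\<in>satlas S. \<forall>(U, \<phi>)\<in>satlas T.
        holomorphic_trans (\<phi> \<circ> f \<circ> inv_into V \<psi>) (\<psi> ` (V \<inter> f -` U)))"

definition biholomorphic :: "'a csurface \<Rightarrow> 'b csurface \<Rightarrow> ('a \<Rightarrow> 'b) \<Rightarrow> bool" where
  "biholomorphic S T f \<longleftrightarrow>
     homeomorphic_map (stop S) (stop T) f \<and>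
     holomorphic_map S T f \<and> holomorphic_map T S (inv_into (pts S) f)"

definition open_part :: "'a csurface \<Rightarrow> 'a set \<Rightarrow> 'a csurface" where
  "open_part S W = \<lparr>stop = subtopology (stop S) W, satlas = (\<lambda>(U, \<phi>). (U \<inter> W, \<phi>)) ` satlas S\<rparr>"

text \<open>Analytic subsets (locally, common zero sets of finitely many holomorphic functions) and
  their irreducible components.\<close>

definition analytic_subset :: "'a csurface \<Rightarrow> 'a set \<Rightarrow> bool" where
  "analytic_subset S Z \<longleftrightarrow> Z \<subseteq> pts S \<and>
     (\<forall>p\<in>pts S. \<exists>U \<phi> H. holo_chart S (U, \<phi>) \<and> p \<in> U \<and> finite H \<and>
        (\<forall>h\<in>H. holomorphic_fun h (\<phi> ` U)) \<and>
        Z \<inter> U = {q\<in>U. \<forall>h\<in>H. h (\<phi> q) = 0})"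

definition irreducible_analytic :: "'a csurface \<Rightarrow> 'a set \<Rightarrow> bool" where
  "irreducible_analytic S Z \<longleftrightarrow> analytic_subset S Z \<and> Z \<noteq> {} \<and>
     (\<forall>Z1 Z2. analytic_subset S Z1 \<and> analytic_subset S Z2 \<and> Z = Z1 \<union> Z2 \<longrightarrow> Z = Z1 \<or> Z = Z2)"

definition irreducible_components :: "'a csurface \<Rightarrow> 'a set \<Rightarrow> 'a set set" where
  "irreducible_components S Y =
     {Z. irreducible_analytic S Z \<and> Z \<subseteq> Y \<and>
         (\<forall>Z'. irreducible_analytic S Z' \<and> Z \<subseteq> Z' \<and> Z' \<subseteq> Y \<longrightarrow> Z' = Z)}"

text \<open>Two curves meet transversally when, at each common point, both are smooth and they are the
  two axes of a suitable holomorphic chart.\<close>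

definition meet_transversally :: "'a csurface \<Rightarrow> 'a set \<Rightarrow> 'a set \<Rightarrow> bool" where
  "meet_transversally S C E \<longleftrightarrow>
     (\<forall>q\<in>C \<inter> E. \<exists>U \<phi>. holo_chart S (U, \<phi>) \<and> q \<in> U \<and> \<phi> q = 0 \<and>
        \<phi> ` (C \<inter> U) = {z\<in>\<phi> ` U. z $ 1 = 0} \<and>
        \<phi> ` (E \<inter> U) = {z\<in>\<phi> ` U. z $ 2 = 0})"


section \<open>The projective plane\<close>

text \<open>Points are the lines through the origin of \<open>\<complex>\<^sup>3\<close>.\<close>

type_synonym pt = "(complex^3) set"

definition proj_pt :: "complex^3 \<Rightarrow> pt" where
  "proj_pt v = vec.span {v}"

definition P2_pts :: "pt set" where
  "P2_pts = proj_pt ` (- {0})"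

definition P2_top :: "pt topology" where
  "P2_top = topology (\<lambda>U. U \<subseteq> P2_pts \<and> open {v. v \<noteq> 0 \<and> proj_pt v \<in> U})"

lemma openin_P2_top:
  "openin P2_top U \<longleftrightarrow> U \<subseteq> P2_pts \<and> open {v. v \<noteq> 0 \<and> proj_pt v \<in> U}"
proof -
  have "istopology (\<lambda>U. U \<subseteq> P2_pts \<and> open {v. v \<noteq> 0 \<and> proj_pt v \<in> U})"
    unfolding istopology_def
  proof (intro conjI allI impI)
    fix S T :: "pt set"
    assume S: "S \<subseteq> P2_pts \<and> open {v. v \<noteq> 0 \<and> proj_pt v \<in> S}"
      and T: "T \<subseteq> P2_pts \<and> open {v. v \<noteq> 0 \<and> proj_pt v \<in> T}"
    have "{v. v \<noteq> 0 \<and> proj_pt v \<in> S \<inter> T} =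
          {v. v \<noteq> 0 \<and> proj_pt v \<in> S} \<inter> {v. v \<noteq> 0 \<and> proj_pt v \<in> T}" by auto
    then show "open {v. v \<noteq> 0 \<and> proj_pt v \<in> S \<inter> T}" using S T by auto
    show "S \<inter> T \<subseteq> P2_pts" using S by auto
  next
    fix K :: "pt set set"
    assume K: "\<forall>S\<in>K. S \<subseteq> P2_pts \<and> open {v. v \<noteq> 0 \<and> proj_pt v \<in> S}"
    have "{v. v \<noteq> 0 \<and> proj_pt v \<in> \<Union>K} = (\<Union>S\<in>K. {v. v \<noteq> 0 \<and> proj_pt v \<in> S})" by auto
    then show "open {v. v \<noteq> 0 \<and> proj_pt v \<in> \<Union>K}" using K by auto
    show "\<Union>K \<subseteq> P2_pts" using K by auto
  qed
  then show ?thesis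
    by (simp add: P2_top_def topology_inverse')
qed

lemma topspace_P2_top [simp]: "topspace P2_top = P2_pts"
proof -
  have "{v::complex^3. v \<noteq> 0 \<and> proj_pt v \<in> P2_pts} = - {0}"
    by (auto simp: P2_pts_def)
  then have "openin P2_top P2_pts"
    by (simp add: openin_P2_top open_Compl)
  then show ?thesis
    by (metis openin_P2_top openin_subset openin_topspace subset_antisym)
qed

text \<open>Affine coordinates on \<open>x\<^sub>i \<noteq> 0\<close>; indices are in the type \<open>3\<close>, hence cyclic.\<close>

definition affine_coord :: "3 \<Rightarrow> pt \<Rightarrow> complex^2" where
  "affine_coord i P = (let v = (THE v. v \<in> P \<and> v $ i = 1) in vector [v $ (i + 1), v $ (i + 2)])"

definition P2 :: "pt csurface" where
  "P2 = \<lparr>stop = P2_top,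
         satlas = (\<lambda>i. ({P\<in>P2_pts. \<exists>v\<in>P. v $ i \<noteq> 0}, affine_coord i)) ` UNIV\<rparr>"


section \<open>Plane curves\<close>

text \<open>Polynomials in three variables over the complex numbers.\<close>

type_synonym mpoly3 = "(3 \<Rightarrow>\<^sub>0 nat) \<Rightarrow>\<^sub>0 complex"

definition peval :: "mpoly3 \<Rightarrow> complex^3 \<Rightarrow> complex" where
  "peval f v = (\<Sum>m\<in>Poly_Mapping.keys f.
     Poly_Mapping.lookup f m * (\<Prod>i\<in>UNIV. v $ i ^ Poly_Mapping.lookup m i))"

definition homogeneous :: "nat \<Rightarrow> mpoly3 \<Rightarrow> bool" where
  "homogeneous d f \<longleftrightarrow> (\<forall>m\<in>Poly_Mapping.keys f. (\<Sum>i\<in>UNIV. Poly_Mapping.lookup m i) = d)"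

text \<open>A reduced plane curve is given by a squarefree form of positive degree, its equation.\<close>

definition plane_curve_eqn :: "mpoly3 \<Rightarrow> bool" where
  "plane_curve_eqn f \<longleftrightarrow> (\<exists>d>0. homogeneous d f) \<and> squarefree f"

definition no_common_component :: "mpoly3 \<Rightarrow> mpoly3 \<Rightarrow> bool" where
  "no_common_component f b \<longleftrightarrow> (\<forall>c. c dvd f \<longrightarrow> c dvd b \<longrightarrow> c dvd 1)"

definition curve :: "mpoly3 \<Rightarrow> pt set" where
  "curve f = {proj_pt v | v. v \<noteq> 0 \<and> peval f v = 0}"

definition smooth_at :: "mpoly3 \<Rightarrow> pt \<Rightarrow> bool" where
  "smooth_at f P \<longleftrightarrow> (\<exists>v. v \<noteq> 0 \<and> P = proj_pt v \<and> peval f v = 0 \<and>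
     (\<exists>i. deriv (\<lambda>t. peval f (v + axis i t)) 0 \<noteq> 0))"


section \<open>Blowing-ups\<close>

text \<open>In a chart \<open>(U, \<phi>)\<close> with coordinates \<open>(x, y)\<close> centred at \<open>p\<close>, the part of the blowing-up over
  \<open>U\<close> is covered by two charts with coordinates \<open>(x, y/x)\<close> and \<open>(x/y, y)\<close>, glued along
  \<open>y/x = 1 / (x/y)\<close>.\<close>

definition blowing_up :: "'a csurface \<Rightarrow> 'a csurface \<Rightarrow> 'a \<Rightarrow> ('a \<Rightarrow> 'a) \<Rightarrow> bool" where
  "blowing_up S' S p \<pi> \<longleftrightarrow>
     complex_surface S' \<and> complex_surface S \<and> p \<in> pts S \<and> holomorphic_map S' S \<pi> \<and>
     biholomorphic (open_part S' {q\<in>pts S'. \<pi> q \<noteq> p}) (open_part S (pts S - {p})) \<pi> \<and>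
     (\<exists>U \<phi> V1 \<psi>1 V2 \<psi>2.
        holo_chart S (U, \<phi>) \<and> p \<in> U \<and> \<phi> p = 0 \<and>
        holo_chart S' (V1, \<psi>1) \<and> holo_chart S' (V2, \<psi>2) \<and>
        V1 \<union> V2 = {q\<in>pts S'. \<pi> q \<in> U} \<and>
        \<psi>1 ` V1 = {w. vector [w $ 1, w $ 1 * w $ 2] \<in> \<phi> ` U} \<and>
        (\<forall>q\<in>V1. \<phi> (\<pi> q) = vector [\<psi>1 q $ 1, \<psi>1 q $ 1 * \<psi>1 q $ 2]) \<and>
        \<psi>2 ` V2 = {w. vector [w $ 1 * w $ 2, w $ 2] \<in> \<phi> ` U} \<and>
        (\<forall>q\<in>V2. \<phi> (\<pi> q) = vector [\<psi>2 q $ 1 * \<psi>2 q $ 2, \<psi>2 q $ 2]) \<and>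
        V1 \<inter> V2 = {q\<in>V1. \<psi>1 q $ 2 \<noteq> 0} \<and>
        V1 \<inter> V2 = {q\<in>V2. \<psi>2 q $ 1 \<noteq> 0} \<and>
        (\<forall>q\<in>V1 \<inter> V2. \<psi>1 q $ 2 * \<psi>2 q $ 1 = 1))"

text \<open>\<open>blowing_ups S \<sigma> N\<close>: the map \<open>\<sigma>\<close> from \<open>S\<close> to the plane is a finite succession of blowing-ups,
  and \<open>N\<close> is the set of points of the plane over which the centres lie. Blowing-ups are
  considered up to isomorphism; the plane itself is first transported to the type of points
  of \<open>S\<close>.\<close>

inductive blowing_ups :: "'a csurface \<Rightarrow> ('a \<Rightarrow> pt) \<Rightarrow> pt set \<Rightarrow> bool" where
  iso: "complex_surface S \<Longrightarrow> biholomorphic S P2 \<sigma> \<Longrightarrow> blowing_ups S \<sigma> {}"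
| step: "blowing_ups S \<sigma> N \<Longrightarrow> blowing_up S' S p \<pi> \<Longrightarrow>
           blowing_ups S' (\<sigma> \<circ> \<pi>) (insert (\<sigma> p) N)"

definition preim :: "'a csurface \<Rightarrow> ('a \<Rightarrow> pt) \<Rightarrow> pt set \<Rightarrow> 'a set" where
  "preim S \<sigma> A = {q\<in>pts S. \<sigma> q \<in> A}"

text \<open>Strict transform of \<open>A\<close>, where \<open>N\<close> is the set of blown-up points of the plane.\<close>

definition strict_transform :: "'a csurface \<Rightarrow> ('a \<Rightarrow> pt) \<Rightarrow> pt set \<Rightarrow> pt set \<Rightarrow> 'a set" where
  "strict_transform S \<sigma> N A = stop S closure_of preim S \<sigma> (A - N)"

text \<open>In the sequel \<open>F\<close> and \<open>B\<close> are the supports of the two curves.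
  \<open>meeting_comps S \<sigma> F B P\<close> are the irreducible components of the total transform of \<open>B\<close> met by
  the strict transform of \<open>F\<close> over \<open>P\<close>.\<close>

definition meeting_comps ::
    "'a csurface \<Rightarrow> ('a \<Rightarrow> pt) \<Rightarrow> pt set \<Rightarrow> pt set \<Rightarrow> pt \<Rightarrow> 'a set set" where
  "meeting_comps S \<sigma> F B P =
     {D \<in> irreducible_components S (preim S \<sigma> B).
        D \<inter> strict_transform S \<sigma> (F \<inter> B) F \<inter> preim S \<sigma> {P} \<noteq> {}}"

text \<open>Since the centres lie over \<open>F \<inter> B\<close>, at least one over each point, the exceptional divisor is
  the preimage of \<open>F \<inter> B\<close>.\<close>

definition admissible :: "'a csurface \<Rightarrow> ('a \<Rightarrow> pt) \<Rightarrow> pt set \<Rightarrow> pt set \<Rightarrow> bool" where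
  "admissible S \<sigma> F B \<longleftrightarrow>
     blowing_ups S \<sigma> (F \<inter> B) \<and>
     meet_transversally S (strict_transform S \<sigma> (F \<inter> B) (F \<union> B)) (preim S \<sigma> (F \<inter> B)) \<and>
     strict_transform S \<sigma> (F \<inter> B) F \<inter> strict_transform S \<sigma> (F \<inter> B) B = {} \<and>
     (\<forall>P\<in>F \<inter> B. \<exists>!D. D \<in> meeting_comps S \<sigma> F B P)"

definition D_comp :: "'a csurface \<Rightarrow> ('a \<Rightarrow> pt) \<Rightarrow> pt set \<Rightarrow> pt set \<Rightarrow> pt \<Rightarrow> 'a set" where
  "D_comp S \<sigma> F B P = (THE D. D \<in> meeting_comps S \<sigma> F B P)"

definition B_hat :: "'a csurface \<Rightarrow> ('a \<Rightarrow> pt) \<Rightarrow> pt set \<Rightarrow> pt set \<Rightarrow> 'a set" where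
  "B_hat S \<sigma> F B =
     \<Union> (irreducible_components S (preim S \<sigma> B) - D_comp S \<sigma> F B ` (F \<inter> B))"


section \<open>Linking invariants\<close>

text \<open>First integral homology of a subspace, and maps induced by inclusions.\<close>

definition H1 :: "'a topology \<Rightarrow> 'a set \<Rightarrow> 'a chain set monoid" where
  "H1 X A = homology_group 1 (subtopology X A)"

definition H1_map ::
    "'a topology \<Rightarrow> 'a set \<Rightarrow> 'b topology \<Rightarrow> 'b set \<Rightarrow> ('a \<Rightarrow> 'b) \<Rightarrow> 'a chain set \<Rightarrow> 'b chain set" where
  "H1_map X A Y A' f = hom_induced 1 (subtopology X A) {} (subtopology Y A') {} f"

definition H1_incl :: "'a topology \<Rightarrow> 'a set \<Rightarrow> 'a set \<Rightarrow> 'a chain set \<Rightarrow> 'a chain set" where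
  "H1_incl X A A' = H1_map X A X A' id"

definition curves_linking ::
    "'a csurface \<Rightarrow> ('a \<Rightarrow> pt) \<Rightarrow> pt set \<Rightarrow> pt set \<Rightarrow> 'a chain set set" where
  "curves_linking S \<sigma> F B =
     (let Ft = strict_transform S \<sigma> (F \<inter> B) F
      in H1_incl (stop S) Ft (pts S - B_hat S \<sigma> F B) ` carrier (H1 (stop S) Ft))"

definition sigma_B :: "'a csurface \<Rightarrow> ('a \<Rightarrow> pt) \<Rightarrow> pt set \<Rightarrow> 'a chain set \<Rightarrow> pt chain set" where
  "sigma_B S \<sigma> B = H1_map (stop S) (pts S - preim S \<sigma> B) P2_top (P2_pts - B) \<sigma>"

definition sigma_B_inv :: "'a csurface \<Rightarrow> ('a \<Rightarrow> pt) \<Rightarrow> pt set \<Rightarrow> pt chain set \<Rightarrow> 'a chain set" where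
  "sigma_B_inv S \<sigma> B = inv_into (carrier (H1 (stop S) (pts S - preim S \<sigma> B))) (sigma_B S \<sigma> B)"

definition j_map ::
    "'a csurface \<Rightarrow> ('a \<Rightarrow> pt) \<Rightarrow> pt set \<Rightarrow> pt set \<Rightarrow> 'a chain set \<Rightarrow> 'a chain set" where
  "j_map S \<sigma> F B = H1_incl (stop S) (pts S - preim S \<sigma> B) (pts S - B_hat S \<sigma> F B)"

definition Ind :: "'a csurface \<Rightarrow> ('a \<Rightarrow> pt) \<Rightarrow> pt set \<Rightarrow> pt set \<Rightarrow> pt chain set set" where
  "Ind S \<sigma> F B =
     kernel (H1 P2_top (P2_pts - B)) (H1 (stop S) (pts S - B_hat S \<sigma> F B))
            (j_map S \<sigma> F B \<circ> sigma_B_inv S \<sigma> B)"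

definition quot_group ::
    "'a csurface \<Rightarrow> ('a \<Rightarrow> pt) \<Rightarrow> pt set \<Rightarrow> pt set \<Rightarrow> pt chain set set monoid" where
  "quot_group S \<sigma> F B = H1 P2_top (P2_pts - B) Mod Ind S \<sigma> F B"

definition psi ::
    "'a csurface \<Rightarrow> ('a \<Rightarrow> pt) \<Rightarrow> pt set \<Rightarrow> pt set \<Rightarrow> pt chain set set \<Rightarrow> 'a chain set" where
  "psi S \<sigma> F B K = the_elem ((j_map S \<sigma> F B \<circ> sigma_B_inv S \<sigma> B) ` K)"

definition phi ::
    "'a csurface \<Rightarrow> ('a \<Rightarrow> pt) \<Rightarrow> pt set \<Rightarrow> pt set \<Rightarrow> 'a chain set \<Rightarrow> pt chain set set" where
  "phi S \<sigma> F B = inv_into (carrier (quot_group S \<sigma> F B)) (psi S \<sigma> F B)"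

definition j_tilde ::
    "'a csurface \<Rightarrow> ('a \<Rightarrow> pt) \<Rightarrow> pt set \<Rightarrow> pt set \<Rightarrow> pt chain set \<Rightarrow> pt chain set set" where
  "j_tilde S \<sigma> F B c =
     Ind S \<sigma> F B #>\<^bsub>H1 P2_top (P2_pts - B)\<^esub> H1_incl P2_top (F - B) (P2_pts - B) c"

text \<open>Integral combinations (homology groups are written multiplicatively).\<close>

definition int_comb :: "('c, 'm) monoid_scheme \<Rightarrow> nat \<Rightarrow> (nat \<Rightarrow> 'c) \<Rightarrow> (nat \<Rightarrow> int) \<Rightarrow> 'c" where
  "int_comb G l g a = (\<Otimes>\<^bsub>G\<^esub>i\<in>{..<l}. g i [^]\<^bsub>G\<^esub> a i)"

definition Z_basis :: "('c, 'm) monoid_scheme \<Rightarrow> nat \<Rightarrow> (nat \<Rightarrow> 'c) \<Rightarrow> bool" where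
  "Z_basis G l g \<longleftrightarrow> (\<forall>i<l. g i \<in> carrier G) \<and>
     bij_betw (int_comb G l g) ({..<l} \<rightarrow>\<^sub>E UNIV) (carrier G)"

text \<open>Classes in \<open>H\<^sub>1(F - B)\<close> whose images form a basis of \<open>H\<^sub>1(F)\<close>.\<close>

definition linking_basis :: "pt set \<Rightarrow> pt set \<Rightarrow> nat \<Rightarrow> (nat \<Rightarrow> pt chain set) \<Rightarrow> bool" where
  "linking_basis F B l g \<longleftrightarrow>
     (\<forall>i<l. g i \<in> carrier (H1 P2_top (F - B))) \<and>
     Z_basis (H1 P2_top F) l (\<lambda>i. H1_incl P2_top (F - B) F (g i))"

definition lks ::
    "'a csurface \<Rightarrow> ('a \<Rightarrow> pt) \<Rightarrow> pt set \<Rightarrow> pt set \<Rightarrow> nat \<Rightarrow> (nat \<Rightarrow> pt chain set) \<Rightarrow>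
     pt chain set set set" where
  "lks S \<sigma> F B l g = j_tilde S \<sigma> F B ` range (int_comb (H1 P2_top (F - B)) l g)"

end

theory Submission
  imports Defs "HOL-Complex_Analysis.Conformal_Mappings"
begin

text \<open>
  Near a point of \<open>F \<inter> B\<close> the curve \<open>F\<close> is the image of a holomorphic disc. A holomorphic disc
  \<open>(x(t), y(t))\<close> lifts through a blowing-up, because one of \<open>y/x\<close> and \<open>x/y\<close> is holomorphic. Hence
  the inverse of \<open>\<sigma>\<close> over \<open>F - B\<close> extends to a continuous map \<open>s\<close> from \<open>F\<close> to the strict transform
  \<open>Ft\<close> of \<open>F\<close> which is left inverse to \<open>\<sigma>\<close>, and \<open>\<sigma>\<close> is injective on the first homology of \<open>Ft\<close>. A class
  of \<open>Ft\<close> has the same image in \<open>F\<close> as a combination of the \<open>g i\<close>, hence comes from the preimage of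
  \<open>F - B\<close>, where both sides of the claim are computed by inclusions.
\<close>

section \<open>Holomorphic discs in complex surfaces\<close>

text \<open>Holomorphy is essential at a centre: a merely continuous arc through it need not lift,
  since y/x may have no limit there. The blowing-ups are undone one at a time, and the induction
  survives because a disc is first shrunk until it meets the finite set of blown-up points at most
  at t = 0; its lifts can then meet later centres only at t = 0. In homology a one-sided inverse of
  \<open>\<sigma>\<close> on \<open>Ft\<close> suffices: it gives injectivity, while the basis of
  H1(F), whose classes live on \<open>F - B\<close>, supplies the class to compare with.\<close>

lemma holomorphic_fun_compose_curve:
  assumes h: "holomorphic_fun h W"
    and c: "\<And>i. (\<lambda>t. c t $ i) holomorphic_on A" and A: "open A" and W: "c ` A \<subseteq> W"
  shows "(\<lambda>t. h (c t)) holomorphic_on A"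
proof (rule holomorphic_onI)
  fix t assume t: "t \<in> A"
  define v :: "complex^2" where "v = (\<chi> i. deriv (\<lambda>t. c t $ i) t)"
  have "((\<lambda>t. c t $ i) has_derivative (\<lambda>x. (x *s v) $ i)) (at t)" for i
  proof -
    have "((\<lambda>t. c t $ i) has_field_derivative deriv (\<lambda>t. c t $ i) t) (at t)"
      using c A t holomorphic_derivI by blast
    then show ?thesis
      unfolding has_field_derivative_def
      by (rule has_derivative_eq_rhs) (simp add: v_def fun_eq_iff mult.commute)
  qed
  then have dc: "(c has_derivative (\<lambda>x. x *s v)) (at t)"
    by (subst has_derivative_componentwise_within)
      (auto simp: Basis_vec_def inner_axis intro!: has_derivative_inner_left)
  obtain D where D: "(h has_derivative D) (at (c t))" "Vector_Spaces.linear (*s) (*) D"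
    using h W t unfolding holomorphic_fun_def by blast
  have "((\<lambda>t. h (c t)) has_derivative (\<lambda>x. D (x *s v))) (at t)"
    using has_derivative_compose[OF dc D(1)] .
  \<comment> \<open>Complex linearity turns the real derivative into multiplication by a complex
    number, hence into a field derivative.\<close>
  moreover have "D (x *s v) = D v * x" for x
    using D(2) by (simp add: Vector_Spaces.linear_iff mult.commute)
  ultimately have "((\<lambda>t. h (c t)) has_field_derivative D v) (at t)"
    unfolding has_field_derivative_def by simp
  then show "(\<lambda>t. h (c t)) field_differentiable at t within A"
    using field_differentiable_at_within field_differentiable_def by blast
qed

text \<open>The whole image lies in one chart, so a single chart tests holomorphy. The chart comes
  from the given atlas, on which \<open>holomorphic_map\<close> is defined, and its injectivity is
  recorded so that \<open>inv_into\<close> cancels without further knowledge of the surface.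
  Constant discs are allowed.\<close>

definition holo_disc :: "'a csurface \<Rightarrow> (complex \<Rightarrow> 'a) \<Rightarrow> real \<Rightarrow> bool" where
  "holo_disc S \<gamma> r \<longleftrightarrow> r > 0 \<and> continuous_map (top_of_set (ball 0 r)) (stop S) \<gamma> \<and>
     (\<exists>(V, \<psi>)\<in>satlas S. inj_on \<psi> V \<and> \<gamma> ` ball 0 r \<subseteq> V \<and>
        (\<forall>i. (\<lambda>t. \<psi> (\<gamma> t) $ i) holomorphic_on ball 0 r))"

text \<open>The part of \<open>complex_surface\<close> that the target of a disc must have. It
  passes easily to \<open>open_part\<close>, where the biholomorphism off the centre is
  stated.\<close>

definition open_injective_charts :: "'a csurface \<Rightarrow> bool" where
  "open_injective_charts S \<longleftrightarrow>
     (\<forall>(U, \<phi>)\<in>satlas S. openin (stop S) U \<and> inj_on \<phi> U) \<and> (\<Union>c\<in>satlas S. fst c) = pts S"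

lemma is_chart_inj_on: "is_chart X (U, \<phi>) \<Longrightarrow> inj_on \<phi> U"
  unfolding is_chart_def homeomorphic_eq_everything_map
  by (auto dest!: openin_subset simp: Int_absorb1)

lemma complex_surface_open_injective_charts:
  assumes "complex_surface S"
  shows "open_injective_charts S"
proof -
  have "openin (stop S) U \<and> inj_on \<phi> U" if "(U, \<phi>) \<in> satlas S" for U \<phi>
  proof -
    have "is_chart (stop S) (U, \<phi>)" using assms that unfolding complex_surface_def by blast
    then show ?thesis using is_chart_inj_on unfolding is_chart_def by auto
  qed
  then show ?thesis
    using assms unfolding complex_surface_def open_injective_charts_def by auto
qed

lemma open_injective_charts_obtain:
  assumes "open_injective_charts S" "x \<in> pts S"
  obtains U \<phi> where "(U, \<phi>) \<in> satlas S" "x \<in> U" "openin (stop S) U" "inj_on \<phi> U"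
proof -
  have "x \<in> (\<Union>c\<in>satlas S. fst c)"
    using assms unfolding open_injective_charts_def by simp
  then obtain c where c: "c \<in> satlas S" "x \<in> fst c" by blast
  then have "(fst c, snd c) \<in> satlas S" by simp
  moreover from this have "openin (stop S) (fst c)" "inj_on (snd c) (fst c)"
    using assms(1) unfolding open_injective_charts_def by blast+
  ultimately show ?thesis using c(2) that by blast
qed

lemma open_injective_charts_open_part:
  assumes "open_injective_charts S" "openin (stop S) W"
  shows "open_injective_charts (open_part S W)"
proof -
  have "(\<Union>c\<in>satlas (open_part S W). fst c) = (\<Union>c\<in>satlas S. fst c) \<inter> W"
    unfolding open_part_def by (auto simp: case_prod_beta)
  then have "(\<Union>c\<in>satlas (open_part S W). fst c) = pts (open_part S W)"
    using assms(1) unfolding open_injective_charts_def by (simp add: open_part_def)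
  moreover have "openin (stop (open_part S W)) U \<and> inj_on \<phi> U"
    if c: "(U, \<phi>) \<in> satlas (open_part S W)" for U \<phi>
  proof -
    obtain U' where U': "(U', \<phi>) \<in> satlas S" "U = U' \<inter> W"
      using c unfolding open_part_def by auto
    then have "openin (stop S) U'" "inj_on \<phi> U'"
      using assms(1) unfolding open_injective_charts_def by auto
    then show ?thesis
      using U'(2) by (auto simp: open_part_def openin_subtopology intro: inj_on_subset)
  qed
  ultimately show ?thesis unfolding open_injective_charts_def by auto
qed

lemma holo_disc_subset:
  assumes "holo_disc S \<gamma> r" "0 < r'" "r' \<le> r"
  shows "holo_disc S \<gamma> r'"
proof -
  have b: "ball 0 r' \<subseteq> ball 0 r" using assms by auto
  obtain V \<psi> where V: "(V, \<psi>) \<in> satlas S" "inj_on \<psi> V" "\<gamma> ` ball 0 r \<subseteq> V"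
    "\<And>i. (\<lambda>t. \<psi> (\<gamma> t) $ i) holomorphic_on ball 0 r"
    and c: "continuous_map (top_of_set (ball 0 r)) (stop S) \<gamma>"
    using assms(1) unfolding holo_disc_def by auto
  have "(\<lambda>t. \<psi> (\<gamma> t) $ i) holomorphic_on ball 0 r'" for i
    using V(4) b holomorphic_on_subset by blast
  then show ?thesis
    unfolding holo_disc_def
    using V(1,2,3) b assms(2) continuous_map_from_subtopology_mono[OF c b] by blast
qed

text \<open>Discs are used as germs at 0: each change of chart costs some radius, and continuity at
  0 pays for it.\<close>

lemma continuous_disc_shrink:
  assumes "continuous_map (top_of_set (ball 0 r)) X \<gamma>" "openin X U" "\<gamma> 0 \<in> U" "0 < r"
  obtains r' :: real where "0 < r'" "r' \<le> r" "\<gamma> ` ball (0::complex) r' \<subseteq> U"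
proof -
  have "openin (top_of_set (ball 0 r)) {t \<in> topspace (top_of_set (ball 0 r)). \<gamma> t \<in> U}"
    using assms(1,2) by (rule openin_continuous_map_preimage)
  then have "open {t \<in> ball 0 r. \<gamma> t \<in> U}"
    by (simp add: openin_open_eq)
  moreover have "0 \<in> {t \<in> ball 0 r. \<gamma> t \<in> U}" using assms by auto
  ultimately obtain e where e: "e > 0" "ball 0 e \<subseteq> {t \<in> ball 0 r. \<gamma> t \<in> U}"
    using openE by blast
  show ?thesis
    by (rule that[of "min e r"]) (use e assms in auto)
qed

lemma holo_disc_holomorphic_map:
  assumes f: "holomorphic_map S T f" and \<gamma>: "holo_disc S \<gamma> r" and T: "open_injective_charts T"
  obtains r' where "0 < r'" "r' \<le> r" "holo_disc T (f \<circ> \<gamma>) r'"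
proof -
  obtain V \<psi> where V: "(V, \<psi>) \<in> satlas S" "inj_on \<psi> V" "\<gamma> ` ball 0 r \<subseteq> V"
    "\<And>i. (\<lambda>t. \<psi> (\<gamma> t) $ i) holomorphic_on ball 0 r" and r: "r > 0"
    and c: "continuous_map (top_of_set (ball 0 r)) (stop S) \<gamma>"
    using \<gamma> unfolding holo_disc_def by auto
  have fc: "continuous_map (top_of_set (ball 0 r)) (stop T) (f \<circ> \<gamma>)"
    using c f continuous_map_compose unfolding holomorphic_map_def by blast
  then have "(f \<circ> \<gamma>) 0 \<in> pts T"
    using r by (auto simp: continuous_map_def)
  then obtain U \<phi> where U: "(U, \<phi>) \<in> satlas T" "f (\<gamma> 0) \<in> U" "openin (stop T) U" "inj_on \<phi> U"
    using open_injective_charts_obtain[OF T, of "f (\<gamma> 0)"] by auto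
  obtain r' where r': "0 < r'" "r' \<le> r" "(f \<circ> \<gamma>) ` ball 0 r' \<subseteq> U"
    using continuous_disc_shrink[OF fc U(3)] U(2) r by auto
  have sub: "ball 0 r' \<subseteq> ball (0::complex) r" using r' by auto
  have hol: "holomorphic_trans (\<phi> \<circ> f \<circ> inv_into V \<psi>) (\<psi> ` (V \<inter> f -` U))"
    using f V(1) U(1) unfolding holomorphic_map_def by fast
  have h1: "(\<lambda>t. (\<phi> \<circ> f \<circ> inv_into V \<psi>) (\<psi> (\<gamma> t)) $ i) holomorphic_on ball 0 r'" for i
  proof (rule holomorphic_fun_compose_curve[where c = "\<lambda>t. \<psi> (\<gamma> t)"])
    show "holomorphic_fun (\<lambda>z. (\<phi> \<circ> f \<circ> inv_into V \<psi>) z $ i) (\<psi> ` (V \<inter> f -` U))"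
      using hol unfolding holomorphic_trans_def by blast
    show "(\<lambda>t. \<psi> (\<gamma> t)) ` ball 0 r' \<subseteq> \<psi> ` (V \<inter> f -` U)"
      using V(3) r'(3) sub by fastforce
  qed (use V(4) holomorphic_on_subset[OF _ sub] in auto)
  have h2: "(\<phi> \<circ> f \<circ> inv_into V \<psi>) (\<psi> (\<gamma> t)) = \<phi> ((f \<circ> \<gamma>) t)" if "t \<in> ball 0 r'" for t
    using V(2,3) sub that by (simp add: image_subset_iff inv_into_f_f subset_iff)
  have h: "(\<lambda>t. \<phi> ((f \<circ> \<gamma>) t) $ i) holomorphic_on ball 0 r'" for i
    using h1 by (rule holomorphic_transform) (simp only: h2)
  have "holo_disc T (f \<circ> \<gamma>) r'"
    unfolding holo_disc_def
    using r' U h continuous_map_from_subtopology_mono[OF fc sub] by blast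
  then show ?thesis using that r' by blast
qed

text \<open>Blowing-ups are described in charts of the maximal atlas, discs in charts of the given
  one. Chart compatibility translates in this direction here, and back in
  \<open>holo_disc_of_holo_chart\<close>.\<close>

lemma holo_disc_in_holo_chart:
  assumes \<gamma>: "holo_disc S \<gamma> r" and U: "holo_chart S (U, \<phi>)" "\<gamma> 0 \<in> U"
  obtains r' where "0 < r'" "r' \<le> r" "\<gamma> ` ball 0 r' \<subseteq> U"
    "\<And>i. (\<lambda>t. \<phi> (\<gamma> t) $ i) holomorphic_on ball 0 r'"
proof -
  obtain V \<psi> where V: "(V, \<psi>) \<in> satlas S" "inj_on \<psi> V" "\<gamma> ` ball 0 r \<subseteq> V"
    "\<And>i. (\<lambda>t. \<psi> (\<gamma> t) $ i) holomorphic_on ball 0 r" and r: "r > 0"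
    and c: "continuous_map (top_of_set (ball 0 r)) (stop S) \<gamma>"
    using \<gamma> unfolding holo_disc_def by auto
  have oU: "openin (stop S) U" using U(1) unfolding holo_chart_def is_chart_def by auto
  obtain r' where r': "0 < r'" "r' \<le> r" "\<gamma> ` ball 0 r' \<subseteq> U"
    using continuous_disc_shrink[OF c oU U(2) r] by auto
  have sub: "ball 0 r' \<subseteq> ball (0::complex) r" using r' by auto
  have hol: "holomorphic_trans (\<phi> \<circ> inv_into V \<psi>) (\<psi> ` (U \<inter> V))"
    using U(1) V(1) unfolding holo_chart_def chart_compatible_def by fast
  have h1: "(\<lambda>t. (\<phi> \<circ> inv_into V \<psi>) (\<psi> (\<gamma> t)) $ i) holomorphic_on ball 0 r'" for i
  proof (rule holomorphic_fun_compose_curve[where c = "\<lambda>t. \<psi> (\<gamma> t)"])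
    show "holomorphic_fun (\<lambda>z. (\<phi> \<circ> inv_into V \<psi>) z $ i) (\<psi> ` (U \<inter> V))"
      using hol unfolding holomorphic_trans_def by blast
    show "(\<lambda>t. \<psi> (\<gamma> t)) ` ball 0 r' \<subseteq> \<psi> ` (U \<inter> V)"
      using V(3) r'(3) sub by fastforce
  qed (use V(4) holomorphic_on_subset[OF _ sub] in auto)
  have h2: "(\<phi> \<circ> inv_into V \<psi>) (\<psi> (\<gamma> t)) = \<phi> (\<gamma> t)" if "t \<in> ball 0 r'" for t
    using V(2,3) sub that by (simp add: image_subset_iff inv_into_f_f subset_iff)
  have h: "(\<lambda>t. \<phi> (\<gamma> t) $ i) holomorphic_on ball 0 r'" for i
    using h1 by (rule holomorphic_transform) (simp only: h2)
  show ?thesis using that r' h by blast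
qed

lemma holo_disc_of_holo_chart:
  assumes S: "complex_surface S" and U: "holo_chart S (U, \<phi>)" and r: "0 < r"
    and w: "\<And>i. (\<lambda>t. w t $ i) holomorphic_on ball 0 r" "w ` ball 0 r \<subseteq> \<phi> ` U"
  obtains r' where "0 < r'" "r' \<le> r" "holo_disc S (inv_into U \<phi> \<circ> w) r'"
proof -
  have oU: "openin (stop S) U"
    and hU: "homeomorphic_map (subtopology (stop S) U) (top_of_set (\<phi> ` U)) \<phi>"
    using U unfolding holo_chart_def is_chart_def by auto
  have inj: "inj_on \<phi> U" using U is_chart_inj_on unfolding holo_chart_def by blast
  have tU: "topspace (subtopology (stop S) U) = U"
    using openin_subset[OF oU] by auto
  obtain g where g: "homeomorphic_maps (subtopology (stop S) U) (top_of_set (\<phi> ` U)) \<phi> g"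
    using hU homeomorphic_map_maps by blast
  then have gc: "continuous_map (top_of_set (\<phi> ` U)) (subtopology (stop S) U) g"
    and g': "\<And>y. y \<in> \<phi> ` U \<Longrightarrow> \<phi> (g y) = y" "\<And>x. x \<in> U \<Longrightarrow> g (\<phi> x) = x"
    unfolding homeomorphic_maps_def tU by auto
  \<comment> \<open>The continuous inverse \<open>g\<close> agrees with
    \<open>inv_into U \<phi>\<close> on the image of the chart.\<close>
  have ic: "continuous_map (top_of_set (\<phi> ` U)) (stop S) (inv_into U \<phi>)"
    by (rule continuous_map_eq[of _ _ g])
      (use gc g' inj in \<open>auto simp: continuous_map_in_subtopology\<close>)
  have "continuous_on (ball 0 r) (\<lambda>t. \<chi> i. w t $ i)"
    using w(1) holomorphic_on_imp_continuous_on by (intro continuous_on_vec_lambda) auto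
  then have "continuous_on (ball 0 r) w" by simp
  then have "continuous_map (top_of_set (ball 0 r)) (top_of_set (\<phi> ` U)) w"
    using w(2) by auto
  then have c: "continuous_map (top_of_set (ball 0 r)) (stop S) (inv_into U \<phi> \<circ> w)"
    using ic by (rule continuous_map_compose)
  have inU: "(inv_into U \<phi> \<circ> w) t \<in> U" if "t \<in> ball 0 r" for t
    using w(2) that by (auto simp: image_subset_iff intro!: inv_into_into)
  have "(inv_into U \<phi> \<circ> w) 0 \<in> pts S"
    using inU[of 0] openin_subset[OF oU] r by auto
  then obtain V \<psi> where V: "(V, \<psi>) \<in> satlas S" "(inv_into U \<phi> \<circ> w) 0 \<in> V"
      "openin (stop S) V" "inj_on \<psi> V"
    using open_injective_charts_obtain[OF complex_surface_open_injective_charts[OF S]] by blast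
  obtain r' where r': "0 < r'" "r' \<le> r" "(inv_into U \<phi> \<circ> w) ` ball 0 r' \<subseteq> V"
    using continuous_disc_shrink[OF c V(3,2) r] by auto
  have sub: "ball 0 r' \<subseteq> ball (0::complex) r" using r' by auto
  have hol: "holomorphic_trans (\<psi> \<circ> inv_into U \<phi>) (\<phi> ` (U \<inter> V))"
    using U(1) V(1) unfolding holo_chart_def chart_compatible_def by fast
  have h: "(\<lambda>t. \<psi> ((inv_into U \<phi> \<circ> w) t) $ i) holomorphic_on ball 0 r'" for i
    unfolding o_def
  proof (rule holomorphic_fun_compose_curve[where c = w])
    show "holomorphic_fun (\<lambda>z. \<psi> (inv_into U \<phi> z) $ i) (\<phi> ` (U \<inter> V))"
      using hol unfolding holomorphic_trans_def by simp
    show "w ` ball 0 r' \<subseteq> \<phi> ` (U \<inter> V)"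
    proof clarify
      fix t :: complex assume t: "t \<in> ball 0 r'"
      then have "w t = \<phi> ((inv_into U \<phi> \<circ> w) t)"
        using w(2) sub by (metis comp_apply f_inv_into_f image_subset_iff subsetD)
      then show "w t \<in> \<phi> ` (U \<inter> V)" using t r'(3) inU sub by blast
    qed
  qed (use w(1) holomorphic_on_subset[OF _ sub] in auto)
  have "holo_disc S (inv_into U \<phi> \<circ> w) r'"
    unfolding holo_disc_def
    using r' V(1,4) h continuous_map_from_subtopology_mono[OF c sub] by blast
  then show ?thesis using that r' by blast
qed

section \<open>Lifting discs through blowing-ups\<close>

text \<open>Near 0 a nonzero holomorphic function is a power of t times a nowhere vanishing factor,
  so of two such functions the one with the smaller order of vanishing divides the other.\<close>

lemma holomorphic_quotient_of_curve:
  fixes x y :: "complex \<Rightarrow> complex"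
  assumes x: "x holomorphic_on ball 0 r" and y: "y holomorphic_on ball 0 r" and r: "0 < r"
    and zero: "x 0 = 0" "y 0 = 0"
  obtains r' h where "0 < r'" "r' \<le> r" "h holomorphic_on ball 0 r'"
    "(\<forall>t\<in>ball 0 r'. y t = x t * h t) \<or> (\<forall>t\<in>ball 0 r'. x t = h t * y t)"
proof (cases "(\<forall>t\<in>ball 0 r. x t = 0) \<or> (\<forall>t\<in>ball 0 r. y t = 0)")
  case True
  \<comment> \<open>A function that vanishes identically is 0 times the other one; this also covers
    the constant disc at the centre.\<close>
  then show ?thesis using that[of r "\<lambda>_. 0"] r by auto
next
  case False
  have factor: "\<exists>n g e. 0 < e \<and> e \<le> r \<and> g holomorphic_on ball 0 e \<and>
      (\<forall>w\<in>ball 0 e. f w = w ^ n * g w) \<and> (\<forall>w\<in>ball 0 e. g w \<noteq> 0)"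
    if f: "f holomorphic_on ball 0 r" "f 0 = 0" "\<exists>t\<in>ball 0 r. f t \<noteq> 0" for f :: "complex \<Rightarrow> complex"
  proof -
    have nc: "\<not> f constant_on ball 0 r"
      using f(2,3) r unfolding constant_on_def by (metis centre_in_ball)
    have zr: "(0::complex) \<in> ball 0 r" using r by simp
    obtain g e n where "0 < e" "ball 0 e \<subseteq> ball (0::complex) r" "g holomorphic_on ball 0 e"
        "\<And>w. w \<in> ball 0 e \<Longrightarrow> f w = (w - 0) ^ n * g w" "\<And>w. w \<in> ball 0 e \<Longrightarrow> g w \<noteq> 0"
      using holomorphic_factor_zero_nonconstant[OF f(1) open_ball connected_ball zr f(2) nc] by metis
    then show ?thesis
      by (intro exI[of _ n] exI[of _ g] exI[of _ e])
        (auto simp: ball_subset_ball_iff)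
  qed
  obtain m u d where u: "0 < d" "d \<le> r" "u holomorphic_on ball 0 d"
    "\<And>w. w \<in> ball 0 d \<Longrightarrow> x w = w ^ m * u w" "\<And>w. w \<in> ball 0 d \<Longrightarrow> u w \<noteq> 0"
    using factor[OF x zero(1)] False by blast
  obtain n v e where v: "0 < e" "e \<le> r" "v holomorphic_on ball 0 e"
    "\<And>w. w \<in> ball 0 e \<Longrightarrow> y w = w ^ n * v w" "\<And>w. w \<in> ball 0 e \<Longrightarrow> v w \<noteq> 0"
    using factor[OF y zero(2)] False by blast
  let ?r = "min d e"
  have hol: "u holomorphic_on ball 0 ?r" "v holomorphic_on ball 0 ?r"
    using u(3) v(3) by (auto intro: holomorphic_on_subset)
  show ?thesis
  proof (cases "m \<le> n")
    case True
    show ?thesis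
    proof (rule that[of ?r "\<lambda>w. w ^ (n - m) * v w / u w"])
      show "(\<lambda>w. w ^ (n - m) * v w / u w) holomorphic_on ball 0 ?r"
        using hol u(5) by (intro holomorphic_intros) auto
      have "y t = x t * (t ^ (n - m) * v t / u t)" if "t \<in> ball 0 ?r" for t
        using u(4,5)[of t] v(4)[of t] that True
        by (simp add: field_simps flip: power_add)
      then show "(\<forall>t\<in>ball 0 ?r. y t = x t * (t ^ (n - m) * v t / u t)) \<or>
          (\<forall>t\<in>ball 0 ?r. x t = t ^ (n - m) * v t / u t * y t)" by blast
    qed (use u v in auto)
  next
    case False
    show ?thesis
    proof (rule that[of ?r "\<lambda>w. w ^ (m - n) * u w / v w"])
      show "(\<lambda>w. w ^ (m - n) * u w / v w) holomorphic_on ball 0 ?r"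
        using hol v(5) by (intro holomorphic_intros) auto
      have "x t = t ^ (m - n) * u t / v t * y t" if "t \<in> ball 0 ?r" for t
        using u(4)[of t] v(4,5)[of t] that False
        by (simp add: field_simps flip: power_add)
      then show "(\<forall>t\<in>ball 0 ?r. y t = x t * (t ^ (m - n) * u t / v t)) \<or>
          (\<forall>t\<in>ball 0 ?r. x t = t ^ (m - n) * u t / v t * y t)" by blast
    qed (use u v in auto)
  qed
qed

lemma holo_disc_open_part:
  assumes "holo_disc S \<gamma> r" "\<gamma> ` ball 0 r \<subseteq> W"
  shows "holo_disc (open_part S W) \<gamma> r"
proof -
  obtain V \<psi> where V: "(V, \<psi>) \<in> satlas S" "inj_on \<psi> V" "\<gamma> ` ball 0 r \<subseteq> V"
    "\<And>i. (\<lambda>t. \<psi> (\<gamma> t) $ i) holomorphic_on ball 0 r" and r: "r > 0"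
    and c: "continuous_map (top_of_set (ball 0 r)) (stop S) \<gamma>"
    using assms(1) unfolding holo_disc_def by auto
  have "(V \<inter> W, \<psi>) \<in> satlas (open_part S W)"
    using V(1) by (force simp: open_part_def)
  moreover have "inj_on \<psi> (V \<inter> W)" using V(2) by (rule inj_on_subset) auto
  moreover have "continuous_map (top_of_set (ball 0 r)) (stop (open_part S W)) \<gamma>"
    using c assms(2) by (auto simp: open_part_def continuous_map_in_subtopology)
  moreover have "\<gamma> ` ball 0 r \<subseteq> V \<inter> W" using V(3) assms(2) by blast
  ultimately show ?thesis using V(4) r unfolding holo_disc_def by blast
qed

text \<open>Charts of the open part are restrictions, and injectivity on the restricted domain does
  not give it on the full one; hence the hypothesis on \<open>S\<close>.\<close>

lemma holo_disc_of_open_part: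
  assumes "holo_disc (open_part S W) \<gamma> r" "open_injective_charts S"
  shows "holo_disc S \<gamma> r"
proof -
  obtain V \<psi> where V: "(V, \<psi>) \<in> satlas (open_part S W)" "inj_on \<psi> V" "\<gamma> ` ball 0 r \<subseteq> V"
    "\<And>i. (\<lambda>t. \<psi> (\<gamma> t) $ i) holomorphic_on ball 0 r" and r: "r > 0"
    and c: "continuous_map (top_of_set (ball 0 r)) (stop (open_part S W)) \<gamma>"
    using assms(1) unfolding holo_disc_def by auto
  obtain U where U: "(U, \<psi>) \<in> satlas S" "V = U \<inter> W"
    using V(1) by (auto simp: open_part_def)
  then have "inj_on \<psi> U" using assms(2) unfolding open_injective_charts_def by blast
  moreover have "continuous_map (top_of_set (ball 0 r)) (stop S) \<gamma>"
    using c by (auto simp: open_part_def continuous_map_in_subtopology)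
  ultimately show ?thesis using V(3,4) U r unfolding holo_disc_def by blast
qed

lemma blowing_upD:
  assumes "blowing_up S' S p \<pi>"
  shows "complex_surface S'" "complex_surface S" "p \<in> pts S" "holomorphic_map S' S \<pi>"
    "biholomorphic (open_part S' {q\<in>pts S'. \<pi> q \<noteq> p}) (open_part S (pts S - {p})) \<pi>"
  using assms unfolding blowing_up_def by - (elim conjE, assumption)+

text \<open>The holomorphic quotient of the two coordinates is the missing coordinate in one of the
  two charts over \<open>U\<close>. The images of these charts are described exactly, so the curve
  built from the quotient stays inside them.\<close>

lemma blowing_up_lift_disc_at_centre:
  assumes b: "blowing_up S' S p \<pi>" and \<gamma>: "holo_disc S \<gamma> r" and p: "\<gamma> 0 = p"
  obtains \<gamma>' r' where "0 < r'" "r' \<le> r" "holo_disc S' \<gamma>' r'" "\<forall>t\<in>ball 0 r'. \<pi> (\<gamma>' t) = \<gamma> t"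
proof -
  have S': "complex_surface S'" using b by (rule blowing_upD)
  obtain U \<phi> V1 \<psi>1 V2 \<psi>2 where
    U: "holo_chart S (U, \<phi>)" "p \<in> U" "\<phi> p = 0" and
    V: "holo_chart S' (V1, \<psi>1)" "holo_chart S' (V2, \<psi>2)" and
    V12: "V1 \<union> V2 = {q\<in>pts S'. \<pi> q \<in> U}" and
    1: "\<psi>1 ` V1 = {w. vector [w $ 1, w $ 1 * w $ 2] \<in> \<phi> ` U}"
       "\<And>q. q\<in>V1 \<Longrightarrow> \<phi> (\<pi> q) = vector [\<psi>1 q $ 1, \<psi>1 q $ 1 * \<psi>1 q $ 2]" and
    2: "\<psi>2 ` V2 = {w. vector [w $ 1 * w $ 2, w $ 2] \<in> \<phi> ` U}"
       "\<And>q. q\<in>V2 \<Longrightarrow> \<phi> (\<pi> q) = vector [\<psi>2 q $ 1 * \<psi>2 q $ 2, \<psi>2 q $ 2]"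
    using b unfolding blowing_up_def by (elim conjE exE) blast
  have inj: "inj_on \<phi> U" using U(1) is_chart_inj_on unfolding holo_chart_def by blast
  obtain r1 where r1: "0 < r1" "r1 \<le> r" "\<gamma> ` ball 0 r1 \<subseteq> U"
    "\<And>i. (\<lambda>t. \<phi> (\<gamma> t) $ i) holomorphic_on ball 0 r1"
    using holo_disc_in_holo_chart[OF \<gamma> U(1)] U(2) p by blast
  obtain r2 h where r2: "0 < r2" "r2 \<le> r1" and h: "h holomorphic_on ball 0 r2"
    "(\<forall>t\<in>ball 0 r2. \<phi> (\<gamma> t) $ 2 = \<phi> (\<gamma> t) $ 1 * h t) \<or>
     (\<forall>t\<in>ball 0 r2. \<phi> (\<gamma> t) $ 1 = h t * \<phi> (\<gamma> t) $ 2)"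
    by (rule holomorphic_quotient_of_curve[OF r1(4)[of 1] r1(4)[of 2] r1(1)])
      (use p U(3) in auto)
  have sub: "ball 0 r2 \<subseteq> ball (0::complex) r1" using r2 by auto
  have hol: "(\<lambda>t. \<phi> (\<gamma> t) $ i) holomorphic_on ball 0 r2" for i
    using r1(4) sub by (rule holomorphic_on_subset)
  have U2: "\<gamma> t \<in> U" if "t \<in> ball 0 r2" for t using r1(3) sub that by blast
  show ?thesis
    using h(2)
  proof
    assume q: "\<forall>t\<in>ball 0 r2. \<phi> (\<gamma> t) $ 2 = \<phi> (\<gamma> t) $ 1 * h t"
    \<comment> \<open>The lift in the coordinates (x, y/x); at t = 0 its second entry is the tangent
      direction chosen by the disc.\<close>
    define w :: "complex \<Rightarrow> complex^2" where "w t = vector [\<phi> (\<gamma> t) $ 1, h t]" for t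
    have e: "vector [w t $ 1, w t $ 1 * w t $ 2] = \<phi> (\<gamma> t)" if "t \<in> ball 0 r2" for t
      using q that by (simp add: w_def vec_eq_iff forall_2)
    have wV: "w ` ball 0 r2 \<subseteq> \<psi>1 ` V1" using e U2 1(1) by auto
    have "(\<lambda>t. w t $ i) holomorphic_on ball 0 r2" for i
      using exhaust_2[of i] hol[of 1] h(1) by (auto simp: w_def)
    then obtain r' where r': "0 < r'" "r' \<le> r2" "holo_disc S' (inv_into V1 \<psi>1 \<circ> w) r'"
      using holo_disc_of_holo_chart[OF S' V(1) r2(1) _ wV] by blast
    have "\<pi> ((inv_into V1 \<psi>1 \<circ> w) t) = \<gamma> t" if "t \<in> ball 0 r'" for t
    proof -
      have t: "t \<in> ball 0 r2" using that r' by auto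
      let ?q = "inv_into V1 \<psi>1 (w t)"
      have q: "?q \<in> V1" "\<psi>1 ?q = w t"
        using wV t by (auto intro!: inv_into_into f_inv_into_f)
      then have "\<phi> (\<pi> ?q) = \<phi> (\<gamma> t)" using 1(2) e[OF t] by metis
      moreover have "\<pi> ?q \<in> U" using q(1) V12 by blast
      ultimately show ?thesis using inj U2[OF t] by (simp add: inj_on_eq_iff)
    qed
    then show ?thesis using that r' r1 r2 by (meson order_trans)
  next
    assume q: "\<forall>t\<in>ball 0 r2. \<phi> (\<gamma> t) $ 1 = h t * \<phi> (\<gamma> t) $ 2"
    \<comment> \<open>The same in the coordinates (x/y, y).\<close>
    define w :: "complex \<Rightarrow> complex^2" where "w t = vector [h t, \<phi> (\<gamma> t) $ 2]" for t
    have e: "vector [w t $ 1 * w t $ 2, w t $ 2] = \<phi> (\<gamma> t)" if "t \<in> ball 0 r2" for t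
      using q that by (simp add: w_def vec_eq_iff forall_2)
    have wV: "w ` ball 0 r2 \<subseteq> \<psi>2 ` V2" using e U2 2(1) by auto
    have "(\<lambda>t. w t $ i) holomorphic_on ball 0 r2" for i
      using exhaust_2[of i] hol[of 2] h(1) by (auto simp: w_def)
    then obtain r' where r': "0 < r'" "r' \<le> r2" "holo_disc S' (inv_into V2 \<psi>2 \<circ> w) r'"
      using holo_disc_of_holo_chart[OF S' V(2) r2(1) _ wV] by blast
    have "\<pi> ((inv_into V2 \<psi>2 \<circ> w) t) = \<gamma> t" if "t \<in> ball 0 r'" for t
    proof -
      have t: "t \<in> ball 0 r2" using that r' by auto
      let ?q = "inv_into V2 \<psi>2 (w t)"
      have q: "?q \<in> V2" "\<psi>2 ?q = w t"
        using wV t by (auto intro!: inv_into_into f_inv_into_f)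
      then have "\<phi> (\<pi> ?q) = \<phi> (\<gamma> t)" using 2(2) e[OF t] by metis
      moreover have "\<pi> ?q \<in> U" using q(1) V12 by blast
      ultimately show ?thesis using inj U2[OF t] by (simp add: inj_on_eq_iff)
    qed
    then show ?thesis using that r' r1 r2 by (meson order_trans)
  qed
qed

lemma blowing_up_openin:
  assumes b: "blowing_up S' S p \<pi>"
  shows "openin (stop S') {q \<in> pts S'. \<pi> q \<noteq> p}" "openin (stop S) (pts S - {p})"
proof -
  have "Hausdorff_space (stop S)" "p \<in> pts S"
    and c: "continuous_map (stop S') (stop S) \<pi>"
    using blowing_upD[OF b] unfolding complex_surface_def holomorphic_map_def by blast+
  then have "closedin (stop S) {p}" by (simp add: closedin_Hausdorff_sing_eq)
  then show o: "openin (stop S) (pts S - {p})" by (simp add: openin_diff)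
  have "openin (stop S') {q \<in> pts S'. \<pi> q \<in> pts S - {p}}"
    using openin_continuous_map_preimage[OF c o] .
  moreover have "{q \<in> pts S'. \<pi> q \<in> pts S - {p}} = {q \<in> pts S'. \<pi> q \<noteq> p}"
    using c by (auto simp: continuous_map_def)
  ultimately show "openin (stop S') {q \<in> pts S'. \<pi> q \<noteq> p}" by simp
qed

lemma blowing_up_lift_disc:
  assumes b: "blowing_up S' S p \<pi>" and \<gamma>: "holo_disc S \<gamma> r"
    and p: "\<And>t. t \<in> ball 0 r \<Longrightarrow> t \<noteq> 0 \<Longrightarrow> \<gamma> t \<noteq> p"
  obtains \<gamma>' r' where "0 < r'" "r' \<le> r" "holo_disc S' \<gamma>' r'" "\<forall>t\<in>ball 0 r'. \<pi> (\<gamma>' t) = \<gamma> t"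
proof (cases "\<gamma> 0 = p")
  case True
  then show ?thesis using blowing_up_lift_disc_at_centre[OF b \<gamma>] that by blast
next
  case False
  let ?W = "pts S - {p}" and ?W' = "{q \<in> pts S'. \<pi> q \<noteq> p}"
  let ?\<rho> = "inv_into (pts (open_part S' ?W')) \<pi>"
  have S': "open_injective_charts S'"
    using complex_surface_open_injective_charts[OF blowing_upD(1)[OF b]] .
  have bh: "holomorphic_map (open_part S ?W) (open_part S' ?W') ?\<rho>"
    "homeomorphic_map (stop (open_part S' ?W')) (stop (open_part S ?W)) \<pi>"
    using blowing_upD(5)[OF b] unfolding biholomorphic_def by - (elim conjE, assumption)+
  \<comment> \<open>The disc now misses the centre altogether, so the inverse of the biholomorphism
    lifts it.\<close>
  have W: "\<gamma> ` ball 0 r \<subseteq> ?W"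
    using \<gamma> p False unfolding holo_disc_def by (fastforce simp: continuous_map_def)
  obtain r' where r': "0 < r'" "r' \<le> r" "holo_disc (open_part S' ?W') (?\<rho> \<circ> \<gamma>) r'"
    using holo_disc_holomorphic_map[OF bh(1) holo_disc_open_part[OF \<gamma> W]
        open_injective_charts_open_part[OF S' blowing_up_openin(1)[OF b]]] .
  have "\<pi> ((?\<rho> \<circ> \<gamma>) t) = \<gamma> t" if "t \<in> ball 0 r'" for t
  proof -
    have "t \<in> ball 0 r" using that r'(2) by auto
    then have "\<gamma> t \<in> ?W" using W by blast
    then have "\<gamma> t \<in> \<pi> ` pts (open_part S' ?W')"
      using homeomorphic_imp_surjective_map[OF bh(2)] by (simp add: open_part_def)
    then show ?thesis by (simp add: f_inv_into_f)
  qed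
  then show ?thesis
    using that[OF r'(1,2) holo_disc_of_open_part[OF r'(3) S']] by blast
qed

text \<open>The inductive step needs the partial lift to avoid the next centre \<open>p\<close> for
  t \<noteq> 0. It does, because \<open>\<sigma> p\<close> is counted among the blown-up points of
  the plane and the partial lift lies over \<open>\<gamma>\<close>.\<close>

lemma blowing_ups_lift_disc:
  assumes "blowing_ups S \<sigma> N" "holo_disc P2 \<gamma> r" "\<And>t. t \<in> ball 0 r \<Longrightarrow> t \<noteq> 0 \<Longrightarrow> \<gamma> t \<notin> N"
  shows "\<exists>\<gamma>' r'. 0 < r' \<and> r' \<le> r \<and> holo_disc S \<gamma>' r' \<and> (\<forall>t\<in>ball 0 r'. \<sigma> (\<gamma>' t) = \<gamma> t)"
  using assms
proof (induction rule: blowing_ups.induct)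
  case (iso S \<sigma>)
  have bh: "holomorphic_map P2 S (inv_into (pts S) \<sigma>)" "homeomorphic_map (stop S) (stop P2) \<sigma>"
    using iso(2) unfolding biholomorphic_def by - (elim conjE, assumption)+
  obtain r' where r': "0 < r'" "r' \<le> r" "holo_disc S (inv_into (pts S) \<sigma> \<circ> \<gamma>) r'"
    using holo_disc_holomorphic_map[OF bh(1) iso(3) complex_surface_open_injective_charts[OF iso(1)]] .
  have "\<sigma> ((inv_into (pts S) \<sigma> \<circ> \<gamma>) t) = \<gamma> t" if "t \<in> ball 0 r'" for t
  proof -
    have "t \<in> ball 0 r" using that r'(2) by auto
    then have "\<gamma> t \<in> pts P2"
      using iso(3) unfolding holo_disc_def continuous_map_def by auto
    then show ?thesis
      using homeomorphic_imp_surjective_map[OF bh(2)] by (simp add: f_inv_into_f)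
  qed
  then show ?case using r' by blast
next
  case (step S \<sigma> N S' p \<pi>)
  obtain \<gamma>1 r1 where 1: "0 < r1" "r1 \<le> r" "holo_disc S \<gamma>1 r1" "\<forall>t\<in>ball 0 r1. \<sigma> (\<gamma>1 t) = \<gamma> t"
    using step.IH[OF step.prems(1)] step.prems(2) by blast
  have "\<gamma>1 t \<noteq> p" if t: "t \<in> ball 0 r1" "t \<noteq> 0" for t
  proof -
    have "t \<in> ball 0 r" using t 1(2) by auto
    then show ?thesis using step.prems(2) 1(4) t by blast
  qed
  then obtain \<gamma>2 r2 where "0 < r2" "r2 \<le> r1" "holo_disc S' \<gamma>2 r2" "\<forall>t\<in>ball 0 r2. \<pi> (\<gamma>2 t) = \<gamma>1 t"
    using blowing_up_lift_disc[OF step.hyps(2) 1(3)] by blast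
  then show ?case using 1 by (intro exI[of _ \<gamma>2] exI[of _ r2]) auto
qed

section \<open>Topology of blowing-ups away from the blown-up points\<close>

lemma homeomorphic_map_restrict_preimage:
  assumes f: "homeomorphic_map (subtopology X {x \<in> topspace X. f x \<in> A}) (subtopology Y A) f" and "B \<subseteq> A"
  shows "homeomorphic_map (subtopology X {x \<in> topspace X. f x \<in> B}) (subtopology Y B) f"
proof -
  have surj: "f ` {x \<in> topspace X. f x \<in> A} = topspace Y \<inter> A"
    using homeomorphic_imp_surjective_map[OF f] by (simp add: Int_absorb1 Collect_restrict)
  have "f ` (topspace (subtopology X {x \<in> topspace X. f x \<in> A}) \<inter> {x \<in> topspace X. f x \<in> B})
      = topspace (subtopology Y A) \<inter> B" (is "?L = ?R")
  proof
    show "?L \<subseteq> ?R" using surj by auto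
    show "?R \<subseteq> ?L"
    proof
      fix y assume y: "y \<in> ?R"
      then have "y \<in> f ` {x \<in> topspace X. f x \<in> A}" using surj by simp
      then show "y \<in> ?L" using y by auto
    qed
  qed
  from homeomorphic_map_subtopologies[OF f this]
  have "homeomorphic_map (subtopology X ({x \<in> topspace X. f x \<in> A} \<inter> {x \<in> topspace X. f x \<in> B}))
      (subtopology Y (A \<inter> B)) f"
    by (simp add: subtopology_subtopology)
  moreover have "{x \<in> topspace X. f x \<in> A} \<inter> {x \<in> topspace X. f x \<in> B} = {x \<in> topspace X. f x \<in> B}"
    "A \<inter> B = B" using assms(2) by auto
  ultimately show ?thesis by simp
qed

lemma blowing_ups_complex_surface: "blowing_ups S \<sigma> N \<Longrightarrow> complex_surface S"
  by (induction rule: blowing_ups.induct) (auto dest: blowing_upD)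

lemma blowing_ups_finite: "blowing_ups S \<sigma> N \<Longrightarrow> finite N"
  by (induction rule: blowing_ups.induct) auto

lemma blowing_ups_continuous_map: "blowing_ups S \<sigma> N \<Longrightarrow> continuous_map (stop S) P2_top \<sigma>"
proof (induction rule: blowing_ups.induct)
  case (iso S \<sigma>)
  then show ?case unfolding biholomorphic_def holomorphic_map_def by (simp add: P2_def)
next
  case (step S \<sigma> N S' p \<pi>)
  have "continuous_map (stop S') (stop S) \<pi>"
    using blowing_upD(4)[OF step.hyps(2)] unfolding holomorphic_map_def by blast
  then show ?case using step.IH by (rule continuous_map_compose)
qed

text \<open>Each centre lies over \<open>N\<close>, so the preimage of a set disjoint from
  \<open>N\<close> avoids every centre and the homeomorphisms compose. The set \<open>A\<close> is
  arbitrary because two instances are compared later: \<open>F - B\<close> and the complement of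
  \<open>B\<close>.\<close>

lemma blowing_ups_homeomorphic_map:
  "blowing_ups S \<sigma> N \<Longrightarrow> A \<inter> N = {} \<Longrightarrow>
     homeomorphic_map (subtopology (stop S) (preim S \<sigma> A)) (subtopology P2_top A) \<sigma>"
proof (induction arbitrary: A rule: blowing_ups.induct)
  case (iso S \<sigma>)
  have "homeomorphic_map (stop S) P2_top \<sigma>"
    using iso(2) unfolding biholomorphic_def by (simp add: P2_def)
  then have "homeomorphic_map (subtopology (stop S) {x \<in> pts S. \<sigma> x \<in> UNIV}) (subtopology P2_top UNIV) \<sigma>"
    by simp
  from homeomorphic_map_restrict_preimage[OF this subset_UNIV] show ?case by (simp add: preim_def)
next
  case (step S \<sigma> N S' p \<pi>)
  let ?A = "preim S \<sigma> A"
  have s: "homeomorphic_map (subtopology (stop S) ?A) (subtopology P2_top A) \<sigma>"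
    using step.IH step.prems by blast
  have "homeomorphic_map (subtopology (stop S') {q \<in> pts S'. \<pi> q \<noteq> p}) (subtopology (stop S) (pts S - {p})) \<pi>"
    using blowing_upD(5)[OF step.hyps(2)] unfolding biholomorphic_def open_part_def by simp
  moreover have c: "\<pi> q \<in> pts S" if "q \<in> pts S'" for q
    using blowing_upD(4)[OF step.hyps(2)] that unfolding holomorphic_map_def continuous_map_def by blast
  then have "{q \<in> pts S'. \<pi> q \<noteq> p} = {q \<in> pts S'. \<pi> q \<in> pts S - {p}}" by blast
  ultimately have "homeomorphic_map (subtopology (stop S') {q \<in> pts S'. \<pi> q \<in> pts S - {p}})
      (subtopology (stop S) (pts S - {p})) \<pi>" by simp
  moreover have "?A \<subseteq> pts S - {p}" using step.prems by (auto simp: preim_def)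
  ultimately have "homeomorphic_map (subtopology (stop S') {q \<in> pts S'. \<pi> q \<in> ?A}) (subtopology (stop S) ?A) \<pi>"
    by (rule homeomorphic_map_restrict_preimage)
  moreover have "{q \<in> pts S'. \<pi> q \<in> ?A} = preim S' (\<sigma> \<circ> \<pi>) A"
    using c by (auto simp: preim_def)
  ultimately have "homeomorphic_map (subtopology (stop S') (preim S' (\<sigma> \<circ> \<pi>) A)) (subtopology (stop S) ?A) \<pi>"
    by simp
  then show ?case using s by (rule homeomorphic_map_compose)
qed

section \<open>Local parametrization of a plane curve at a smooth point\<close>

text \<open>The inverse function theorem for the map (s, z) \<mapsto> (s, G(s, z)) gives a
  differentiable local inverse over the reals; differentiating G(s, h(s)) = 0 then shows that the
  derivative of \<open>h\<close> is multiplication by -Gs/Gz, so \<open>h\<close> is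
  holomorphic.\<close>

lemma holomorphic_implicit_function:
  fixes G Gs Gz :: "complex \<times> complex \<Rightarrow> complex"
  assumes der: "\<And>p. (G has_derivative (\<lambda>h. Gs p * fst h + Gz p * snd h)) (at p)"
    and cont: "continuous_on UNIV Gs" "continuous_on UNIV Gz"
    and zero: "G (s0, z0) = 0" and nz: "Gz (s0, z0) \<noteq> 0"
  obtains e d h where "0 < e" "0 < d" "h holomorphic_on ball s0 e" "h ` ball s0 e \<subseteq> ball z0 d"
    "\<And>s z. s \<in> ball s0 e \<Longrightarrow> z \<in> ball z0 d \<Longrightarrow> G (s, z) = 0 \<longleftrightarrow> z = h s"
proof -
  define f where "f p = (fst p, G p)" for p
  define f' where "f' p = Blinfun (\<lambda>h. (fst h, Gs p * fst h + Gz p * snd h))" for p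
  have bl: "bounded_linear (\<lambda>h. (fst h, Gs p * fst h + Gz p * snd h))" for p
    by (intro bounded_linear_intros bounded_linear_Pair bounded_linear_add
        bounded_linear_const_mult bounded_linear_fst bounded_linear_snd)
  have f'_apply: "blinfun_apply (f' p) h = (fst h, Gs p * fst h + Gz p * snd h)" for p h
    unfolding f'_def using bl by (simp add: bounded_linear_Blinfun_apply)
  have derf: "(f has_derivative blinfun_apply (f' p)) (at p)" for p
    unfolding f_def f'_apply by (intro derivative_intros der)
  have contf: "continuous_on UNIV f'"
    by (rule continuous_on_blinfun_componentwise)
      (auto simp: f'_apply intro!: continuous_intros cont)
  let ?p = "(s0, z0)"
  \<comment> \<open>The inverse of the triangular Jacobian at the base point.\<close>
  define invf where "invf = Blinfun (\<lambda>h. (fst h, (snd h - Gs ?p * fst h) / Gz ?p))"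
  have bli: "bounded_linear (\<lambda>h. (fst h, (snd h - Gs ?p * fst h) / Gz ?p))"
    by (intro bounded_linear_Pair bounded_linear_divide[THEN bounded_linear_compose] bounded_linear_sub
        bounded_linear_const_mult bounded_linear_fst bounded_linear_snd)
  have inv: "invf o\<^sub>L f' ?p = id_blinfun"
    by (rule blinfun_eqI)
      (simp add: invf_def bounded_linear_Blinfun_apply[OF bli] f'_apply nz)
  obtain U' V g g' where U': "open U'" "?p \<in> U'" and V: "open V" "f ?p \<in> V"
    and hom: "homeomorphism U' V f g"
    and g': "\<And>y. y \<in> V \<Longrightarrow> (g has_derivative (g' y)) (at y)"
      "\<And>y. y \<in> V \<Longrightarrow> g' y = inv_into UNIV (blinfun_apply (f' (g y)))"
      "\<And>y. y \<in> V \<Longrightarrow> bij (blinfun_apply (f' (g y)))"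
    using inverse_function_theorem[OF open_UNIV derf contf UNIV_I inv] by metis
  obtain A B where AB: "open A" "open B" "?p \<in> A \<times> B" "A \<times> B \<subseteq> U'"
    using U' open_prod_elim by metis
  obtain d1 where d1: "0 < d1" "ball s0 d1 \<subseteq> A" using AB openE by (metis mem_Sigma_iff)
  obtain d where d: "0 < d" "ball z0 d \<subseteq> B" using AB openE by (metis mem_Sigma_iff)
  \<comment> \<open>The zero set of \<open>G\<close> is carried by \<open>f\<close> to the axis with
    second coordinate 0, and \<open>g\<close> brings it back.\<close>
  define h where "h s = snd (g (s, 0))" for s
  have gp: "g (s0, 0) = ?p"
    using hom U'(2) zero unfolding homeomorphism_def f_def by force
  let ?T = "{y \<in> V. snd (g y) \<in> ball z0 d}"
  have "continuous_on V (\<lambda>y. snd (g y))"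
    using hom unfolding homeomorphism_def by (intro continuous_on_snd) blast
  then have "open (V \<inter> (\<lambda>y. snd (g y)) -` ball z0 d)"
    using V(1) by (intro continuous_open_preimage) auto
  then have "open ?T" by (simp add: Int_def vimage_def conj_commute)
  then have "open ((\<lambda>s. (s, 0)) -` ?T)"
    by (intro open_vimage continuous_intros)
  moreover have "s0 \<in> (\<lambda>s. (s, 0)) -` ?T"
    using V(2) gp d zero by (simp add: f_def)
  ultimately obtain e1 where e1: "0 < e1" "ball s0 e1 \<subseteq> (\<lambda>s. (s, 0)) -` ?T"
    using openE by blast
  let ?e = "min e1 d1"
  have inV: "(s, 0) \<in> V" "h s \<in> ball z0 d" if "s \<in> ball s0 ?e" for s
  proof -
    have "s \<in> ball s0 e1" using that by simp
    then have "s \<in> (\<lambda>s. (s, 0)) -` ?T" using e1(2) by blast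
    then show "(s, 0) \<in> V" "h s \<in> ball z0 d" by (simp_all add: h_def)
  qed
  have fg: "f (g y) = y" if "y \<in> V" for y using hom that unfolding homeomorphism_def by blast
  have gf: "g (f x) = x" if "x \<in> U'" for x using hom that unfolding homeomorphism_def by blast
  have gh: "g (s, 0) = (s, h s)" "G (s, h s) = 0" if "s \<in> ball s0 ?e" for s
  proof -
    have "f (g (s, 0)) = (s, 0)" using fg inV(1) that by blast
    then show "g (s, 0) = (s, h s)" "G (s, h s) = 0"
      unfolding f_def h_def by (auto simp: prod_eq_iff) (metis prod.collapse)
  qed
  show ?thesis
  proof (rule that[of ?e d h])
    show "h ` ball s0 ?e \<subseteq> ball z0 d" using inV by blast
    show "G (s, z) = 0 \<longleftrightarrow> z = h s" if "s \<in> ball s0 ?e" "z \<in> ball z0 d" for s z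
    proof
      assume G: "G (s, z) = 0"
      have "(s, z) \<in> U'" using that d(2) d1(2) AB(4) by (auto simp: subset_iff)
      then have "g (f (s, z)) = (s, z)" by (rule gf)
      then show "z = h s" using G by (simp add: f_def h_def)
    qed (use gh(2) that in simp)
    show "h holomorphic_on ball s0 ?e"
    proof (rule holomorphic_onI)
      fix s assume s: "s \<in> ball s0 ?e"
      \<comment> \<open>The derivative of t \<mapsto> g(t, 0) at \<open>s\<close> in direction
        \<open>a\<close>; its second component is the derivative of \<open>h\<close>.\<close>
      define x where "x a = g' (s, 0) (a, 0)" for a :: complex
      have bij: "bij (blinfun_apply (f' (g (s, 0))))" using g'(3) inV(1)[OF s] .
      \<comment> \<open>Bijectivity of the Jacobian at every point of the local inverse shows that
        \<open>Gz\<close> is nonzero along the whole graph, not only at its base point.\<close>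
      have "blinfun_apply (f' (g (s, 0))) (0, 1) \<noteq> blinfun_apply (f' (g (s, 0))) (0, 0)"
        using bij by (simp add: bij_def inj_eq)
      then have Gz: "Gz (s, h s) \<noteq> 0" by (simp add: f'_apply gh(1)[OF s])
      have x: "blinfun_apply (f' (g (s, 0))) (x a) = (a, 0)" for a
        unfolding x_def g'(2)[OF inV(1)[OF s]]
        using bij by (simp add: bij_is_surj surj_f_inv_f)
      have "Gs (s, h s) * a + Gz (s, h s) * snd (x a) = 0" for a
        using x[of a] by (auto simp: f'_apply gh(1)[OF s])
      then have "Gz (s, h s) * snd (x a) = - Gs (s, h s) * a" for a
        by (metis add_eq_0_iff mult_minus_left)
      then have "snd (x a) = - (Gs (s, h s) / Gz (s, h s)) * a" for a
        using Gz by (simp add: field_simps)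
      moreover have "((\<lambda>t. g (t, 0)) has_derivative x) (at s)"
        unfolding x_def
        by (rule has_derivative_compose[where f = "\<lambda>t. (t, 0)", OF _ g'(1)[OF inV(1)[OF s]]])
          (auto intro!: derivative_eq_intros)
      then have "(h has_derivative (\<lambda>a. snd (x a))) (at s)"
        unfolding h_def by (rule has_derivative_snd)
      ultimately have "(h has_field_derivative - (Gs (s, h s) / Gz (s, h s))) (at s)"
        unfolding has_field_derivative_def by (simp only:)
      then show "h field_differentiable at s within ball s0 ?e"
        using field_differentiable_at_within field_differentiable_def by blast
    qed
  qed (use e1 d1 d in auto)
qed

text \<open>The \<open>D i\<close> are the partial derivatives. Their continuity is what the
  implicit function theorem asks for.\<close>

lemma peval_has_derivative:
  obtains D :: "3 \<Rightarrow> complex^3 \<Rightarrow> complex" where "\<And>i. continuous_on UNIV (D i)"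
    "\<And>v. (peval f has_derivative (\<lambda>h. \<Sum>i\<in>UNIV. D i v * h $ i)) (at v)"
proof -
  let ?c = "Poly_Mapping.lookup f" and ?e = "Poly_Mapping.lookup :: (3 \<Rightarrow>\<^sub>0 nat) \<Rightarrow> 3 \<Rightarrow> nat"
  \<comment> \<open>For exponent 0 the truncated exponent \<open>0 - 1\<close> is harmless, since
    the factor \<open>of_nat 0\<close> kills the term.\<close>
  define E where "E i v m = of_nat (?e m i) * (v::complex^3) $ i ^ (?e m i - 1) * (\<Prod>j\<in>UNIV - {i}. v $ j ^ ?e m j)" for i v m
  define D where "D i v = (\<Sum>m\<in>Poly_Mapping.keys f. ?c m * E i v m)" for i v
  have "continuous_on UNIV (D i)" for i
    unfolding D_def E_def by (intro continuous_intros)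
  moreover have "(peval f has_derivative (\<lambda>h. \<Sum>i\<in>UNIV. D i v * h $ i)) (at v)" for v
  proof -
    have "((\<lambda>v::complex^3. v $ i ^ n) has_derivative (\<lambda>h. of_nat n * v $ i ^ (n - 1) * h $ i)) (at v)" for i n
      by (rule derivative_eq_intros bounded_linear_imp_has_derivative[OF bounded_linear_vec_nth] refl)+
        (auto simp: fun_eq_iff)
    then have "((\<lambda>v::complex^3. \<Prod>i\<in>UNIV. v $ i ^ ?e m i) has_derivative
        (\<lambda>h. \<Sum>i\<in>UNIV. (of_nat (?e m i) * v $ i ^ (?e m i - 1) * h $ i) * (\<Prod>j\<in>UNIV - {i}. v $ j ^ ?e m j))) (at v)" for m
      by (intro has_derivative_prod) blast
    then have "((\<lambda>v::complex^3. \<Prod>i\<in>UNIV. v $ i ^ ?e m i) has_derivative (\<lambda>h. \<Sum>i\<in>UNIV. E i v m * h $ i)) (at v)" for m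
      by (simp add: E_def mult_ac)
    then have "(peval f has_derivative (\<lambda>h. \<Sum>m\<in>Poly_Mapping.keys f. ?c m * (\<Sum>i\<in>UNIV. E i v m * h $ i))) (at v)"
      unfolding peval_def by (intro has_derivative_sum has_derivative_mult_right)
    moreover have "(\<Sum>m\<in>Poly_Mapping.keys f. ?c m * (\<Sum>i\<in>UNIV. E i v m * h $ i)) = (\<Sum>i\<in>UNIV. D i v * h $ i)" for h
      unfolding D_def sum_distrib_left sum_distrib_right
      by (subst sum.swap) (simp add: mult_ac)
    ultimately show ?thesis by simp
  qed
  ultimately show ?thesis using that by blast
qed

section \<open>Forms and homogeneous coordinates on the projective plane\<close>

lemma peval_homogeneous:
  assumes "homogeneous d f"
  shows "peval f (c *s v) = c ^ d * peval f v"
proof -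
  have "(\<Prod>i\<in>UNIV. (c *s v) $ i ^ Poly_Mapping.lookup m i) = c ^ d * (\<Prod>i\<in>UNIV. v $ i ^ Poly_Mapping.lookup m i)"
    if "m \<in> Poly_Mapping.keys f" for m
  proof -
    have "(\<Sum>i\<in>UNIV. Poly_Mapping.lookup m i) = d"
      using assms that unfolding homogeneous_def by blast
    then show ?thesis by (simp add: power_mult_distrib prod.distrib flip: power_sum)
  qed
  then show ?thesis
    unfolding peval_def sum_distrib_left by (intro sum.cong) (simp_all add: mult_ac)
qed

lemma proj_pt_eq_iff:
  assumes "u \<noteq> 0"
  shows "proj_pt u = proj_pt v \<longleftrightarrow> (\<exists>c. c \<noteq> 0 \<and> v = c *s u)"
proof
  assume e: "proj_pt u = proj_pt v"
  then have "v \<in> vec.span {u}" "u \<in> vec.span {v}"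
    unfolding proj_pt_def by (metis insertI1 vec.span_base)+
  then obtain a where a: "v = a *s u"
    by (auto simp: vec.span_singleton)
  moreover have "a \<noteq> 0"
    using \<open>u \<in> vec.span {v}\<close> a assms by (auto simp: vec.span_singleton)
  ultimately show "\<exists>c. c \<noteq> 0 \<and> v = c *s u" by blast
next
  assume "\<exists>c. c \<noteq> 0 \<and> v = c *s u"
  then obtain c where c: "c \<noteq> 0" "v = c *s u" by blast
  have "range (\<lambda>k. k *s u) = range (\<lambda>k. k *s v)"
  proof -
    have "k *s u = (k / c) *s v" "k *s v = (k * c) *s u" for k
      using c by (simp_all add: vector_smult_assoc)
    then show ?thesis by (metis (no_types, lifting) image_subset_iff rangeI subset_antisym)
  qed
  then show "proj_pt u = proj_pt v"
    unfolding proj_pt_def by (simp add: vec.span_singleton)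
qed

text \<open>\<open>curve\<close> asks for some representative on which the form vanishes;
  homogeneity makes every representative do.\<close>

lemma proj_pt_in_curve_iff:
  assumes "homogeneous d f" "u \<noteq> 0"
  shows "proj_pt u \<in> curve f \<longleftrightarrow> peval f u = 0"
proof
  assume "proj_pt u \<in> curve f"
  then obtain v where v: "v \<noteq> 0" "peval f v = 0" "proj_pt v = proj_pt u"
    unfolding curve_def by auto
  then obtain c where "u = c *s v" using proj_pt_eq_iff[OF v(1)] by blast
  then show "peval f u = 0" using peval_homogeneous[OF assms(1)] v(2) by simp
qed (use assms(2) curve_def in blast)

lemma continuous_on_peval: "continuous_on UNIV (peval f)"
proof -
  obtain D where "\<And>v. (peval f has_derivative (\<lambda>h. \<Sum>i\<in>UNIV. D i v * h $ i)) (at v)"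
    using peval_has_derivative by blast
  then show ?thesis
    using has_derivative_continuous by (intro continuous_at_imp_continuous_on) blast
qed

lemma closedin_curve:
  assumes "homogeneous d f"
  shows "closedin P2_top (curve f)"
proof -
  have "{v. v \<noteq> 0 \<and> proj_pt v \<in> P2_pts - curve f} = - {0} \<inter> {v. peval f v \<noteq> 0}"
    using proj_pt_in_curve_iff[OF assms] by (auto simp: P2_pts_def)
  moreover have "open {v. peval f v \<noteq> 0}"
    using continuous_on_peval by (intro open_Collect_neq) auto
  then have "open (- {0} \<inter> {v. peval f v \<noteq> 0})" by (intro open_Int) auto
  ultimately have "openin P2_top (P2_pts - curve f)"
    by (simp add: openin_P2_top)
  moreover have "curve f \<subseteq> P2_pts" unfolding curve_def P2_pts_def by auto
  ultimately show ?thesis by (simp add: closedin_def)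
qed

text \<open>The affine coordinate u_m / u_k. As division by 0 gives 0,
  \<open>coord_ratio k k Q\<close> is 1 or 0, and its being nonzero says that \<open>Q\<close> lies
  in the affine chart of index \<open>k\<close>.\<close>

definition coord_ratio :: "3 \<Rightarrow> 3 \<Rightarrow> pt \<Rightarrow> complex" where
  "coord_ratio k m Q = (let u = (SOME u. u \<noteq> 0 \<and> Q = proj_pt u) in u $ m / u $ k)"

lemma coord_ratio_proj_pt:
  assumes "u \<noteq> 0"
  shows "coord_ratio k m (proj_pt u) = u $ m / u $ k"
proof -
  define v where "v = (SOME v. v \<noteq> 0 \<and> proj_pt u = proj_pt v)"
  have "v \<noteq> 0 \<and> proj_pt u = proj_pt v"
    unfolding v_def by (rule someI_ex) (use assms in blast)
  then obtain c where "c \<noteq> 0" "v = c *s u" using proj_pt_eq_iff[OF assms] by blast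
  then show ?thesis unfolding coord_ratio_def v_def[symmetric] by simp
qed

lemma continuous_map_proj_pt: "continuous_map (top_of_set (- {0})) P2_top proj_pt"
proof -
  have "openin (top_of_set (- {0})) {v \<in> - {0}. proj_pt v \<in> U}" if "openin P2_top U" for U
  proof -
    have "{v \<in> - {0}. proj_pt v \<in> U} = {v. v \<noteq> 0 \<and> proj_pt v \<in> U}" by auto
    then show ?thesis using that by (auto simp: openin_P2_top open_subset)
  qed
  then show ?thesis by (auto simp: continuous_map_def P2_pts_def)
qed

lemma openin_coord_ratio:
  assumes "\<And>m. open (T m)"
  shows "openin P2_top {Q \<in> P2_pts. coord_ratio k k Q \<noteq> 0 \<and> (\<forall>m. coord_ratio k m Q \<in> T m)}" (is "openin _ ?A")
proof -
  have "u \<noteq> 0" if "u $ k \<noteq> 0" for u :: "complex^3" using that by auto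
  moreover from this have "coord_ratio k m (proj_pt u) = u $ m / u $ k" if "u $ k \<noteq> 0" for u m
    using that coord_ratio_proj_pt by blast
  ultimately have "{u. u \<noteq> 0 \<and> proj_pt u \<in> ?A} = {u. u $ k \<noteq> 0} \<inter> (\<Inter>m. (\<lambda>u. u $ m / u $ k) -` T m)"
    by (auto simp: coord_ratio_proj_pt P2_pts_def)
  also have "\<dots> = (\<Inter>m. {u. u $ k \<noteq> 0} \<inter> (\<lambda>u. u $ m / u $ k) -` T m)" by auto
  also have "open \<dots>"
  proof (intro open_INT ballI)
    fix m :: 3
    have "open {u::complex^3. u $ k \<noteq> 0}"
      by (intro open_Collect_neq continuous_intros)
    then show "open ({u::complex^3. u $ k \<noteq> 0} \<inter> (\<lambda>u. u $ m / u $ k) -` T m)"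
      using assms by (intro continuous_open_preimage continuous_intros) auto
  qed simp
  finally show ?thesis by (auto simp: openin_P2_top)
qed

lemma continuous_map_coord_ratio:
  "continuous_map (subtopology P2_top {Q. coord_ratio k k Q \<noteq> 0}) euclidean (coord_ratio k m)"
  unfolding continuous_map_def
proof (intro conjI allI impI)
  fix U :: "complex set" assume "openin euclidean U"
  \<comment> \<open>A box that constrains only the coordinate \<open>m\<close>.\<close>
  then have "openin P2_top {Q \<in> P2_pts. coord_ratio k k Q \<noteq> 0 \<and> (\<forall>m'. coord_ratio k m' Q \<in> (if m' = m then U else UNIV))}"
    by (intro openin_coord_ratio) auto
  moreover have "{Q \<in> topspace (subtopology P2_top {Q. coord_ratio k k Q \<noteq> 0}). coord_ratio k m Q \<in> U} =
     {Q \<in> P2_pts. coord_ratio k k Q \<noteq> 0 \<and> (\<forall>m'. coord_ratio k m' Q \<in> (if m' = m then U else UNIV))} \<inter> {Q. coord_ratio k k Q \<noteq> 0}"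
    by auto
  ultimately show "openin (subtopology P2_top {Q. coord_ratio k k Q \<noteq> 0})
      {Q \<in> topspace (subtopology P2_top {Q. coord_ratio k k Q \<noteq> 0}). coord_ratio k m Q \<in> U}"
    unfolding openin_subtopology by blast
qed auto

text \<open>Shows that \<open>affine_coord k\<close> lists all coordinates other than the
  \<open>k\<close>-th one.\<close>

lemma UNIV_3_cyclic: "(UNIV :: 3 set) = {k, k + 1, k + 2}"
proof -
  have "\<forall>k x::3. x \<in> {k, k + 1, k + 2}" by (simp add: forall_3)
  then show ?thesis by blast
qed

lemma affine_coord_proj_pt:
  assumes "u $ k \<noteq> 0"
  shows "affine_coord k (proj_pt u) = vector [u $ (k + 1) / u $ k, u $ (k + 2) / u $ k]"
proof -
  have "(THE v. v \<in> proj_pt u \<and> v $ k = 1) = (1 / u $ k) *s u"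
    using assms by (intro the_equality) (auto simp: proj_pt_def vec.span_singleton field_simps)
  then show ?thesis by (simp add: affine_coord_def)
qed

lemma inj_on_affine_coord: "inj_on (affine_coord k) {P\<in>P2_pts. \<exists>v\<in>P. v $ k \<noteq> 0}"
proof (rule inj_onI)
  fix P Q assume P: "P \<in> {P\<in>P2_pts. \<exists>v\<in>P. v $ k \<noteq> 0}" and Q: "Q \<in> {P\<in>P2_pts. \<exists>v\<in>P. v $ k \<noteq> 0}"
    and e: "affine_coord k P = affine_coord k Q"
  have *: "\<exists>u. u \<noteq> 0 \<and> R = proj_pt u \<and> u $ k \<noteq> 0" if "R \<in> {P\<in>P2_pts. \<exists>v\<in>P. v $ k \<noteq> 0}" for R
    using that unfolding P2_pts_def by (auto simp: proj_pt_def vec.span_singleton)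
  obtain u v where u: "u \<noteq> 0" "P = proj_pt u" "u $ k \<noteq> 0" and v: "v \<noteq> 0" "Q = proj_pt v" "v $ k \<noteq> 0"
    using *[OF P] *[OF Q] by blast
  have "u $ (k + 1) / u $ k = v $ (k + 1) / v $ k" "u $ (k + 2) / u $ k = v $ (k + 2) / v $ k"
    using e u v by (simp_all add: affine_coord_proj_pt vec_eq_iff forall_2)
  then have "v $ m = (v $ k / u $ k *s u) $ m" for m
    using UNIV_3_cyclic[of k] UNIV_I[of m] u(3) v(3) by (auto simp: field_simps)
  then have "v = (v $ k / u $ k) *s u" unfolding vec_eq_iff by blast
  moreover have "v $ k / u $ k \<noteq> 0" using u(3) v(3) by simp
  ultimately have "proj_pt u = proj_pt v" using proj_pt_eq_iff[OF u(1)] by blast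
  then show "P = Q" using u(2) v(2) by simp
qed

text \<open>A partial derivative in the direction of a coordinate axis through \<open>v\<close> would vanish by
  homogeneity, so the axis of a nonzero partial derivative leaves a nonzero coordinate of \<open>v\<close>.\<close>

lemma smooth_at_coordinates:
  assumes f: "homogeneous d f" "0 < d" and P: "smooth_at f P"
  obtains v k i where "v \<noteq> 0" "P = proj_pt v" "peval f v = 0" "v $ k \<noteq> 0" "i \<noteq> k"
    "deriv (\<lambda>t. peval f (v + axis i t)) 0 \<noteq> 0"
proof -
  obtain v i where v: "v \<noteq> 0" "P = proj_pt v" "peval f v = 0"
    and i: "deriv (\<lambda>t. peval f (v + axis i t)) 0 \<noteq> 0"
    using P unfolding smooth_at_def by blast
  have "\<exists>k. k \<noteq> i \<and> v $ k \<noteq> 0"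
  proof (rule ccontr)
    assume "\<not> ?thesis"
    then have z: "v $ k = 0" if "k \<noteq> i" for k using that by blast
    then have vi: "v $ i \<noteq> 0" using v(1) by (metis vec_eq_iff zero_index)
    have e: "v + axis i t = (1 + t / v $ i) *s v" for t
      using z vi by (auto simp: vec_eq_iff axis_def field_simps)
    have "peval f (v + axis i t) = 0" for t
      unfolding e peval_homogeneous[OF f(1)] v(3) by simp
    then show False using i by simp
  qed
  then obtain k where k: "k \<noteq> i" "v $ k \<noteq> 0" by blast
  show ?thesis using that[OF v k(2) k(1)[symmetric] i] .
qed

text \<open>In the affine slice through \<open>v\<close> where the \<open>k\<close>-th coordinate is
  constant, the implicit function theorem solves for the \<open>i\<close>-th coordinate as a
  function of the remaining one. The continuous map \<open>\<kappa>\<close> recovers the parameter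
  of the disc; it turns lifts of the disc into maps defined on the curve near
  \<open>P\<close>.\<close>

lemma curve_disc_at_smooth_point:
  assumes f: "homogeneous d f" "0 < d" and P: "smooth_at f P"
  obtains \<gamma> r W \<kappa> where "holo_disc P2 \<gamma> r" "\<gamma> 0 = P" "openin P2_top W" "W \<inter> curve f = \<gamma> ` ball 0 r"
    "continuous_map (subtopology P2_top W) euclidean \<kappa>" "\<And>t. t \<in> ball 0 r \<Longrightarrow> \<kappa> (\<gamma> t) = t"
proof -
  obtain v k i where v: "v \<noteq> 0" "P = proj_pt v" "peval f v = 0" "v $ k \<noteq> 0" "i \<noteq> k"
    and i: "deriv (\<lambda>t. peval f (v + axis i t)) 0 \<noteq> 0"
    using smooth_at_coordinates[OF f P] by metis
  obtain D where D: "\<And>i. continuous_on UNIV (D i)"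
    "\<And>v. (peval f has_derivative (\<lambda>h. \<Sum>i\<in>UNIV. D i v * h $ i)) (at v)"
    using peval_has_derivative[of f] by blast
  have sum_axis: "(\<Sum>m\<in>UNIV. D m u * axis i h $ m) = D i u * h" for u h
    by (simp add: axis_def if_distrib[of "\<lambda>x. D _ u * x"] cong: if_cong)
  \<comment> \<open>By the chain rule the derivative in \<open>smooth_at\<close> is the partial
    derivative \<open>D i v\<close>.\<close>
  have "((\<lambda>t. v + axis i t) has_derivative (\<lambda>h. axis i h)) (at 0)"
  proof (subst has_derivative_componentwise_within, intro ballI)
    fix b :: "complex^3" assume "b \<in> Basis"
    then obtain m c where b: "b = axis m c" by (auto simp: Basis_vec_def)
    show "((\<lambda>t. (v + axis i t) \<bullet> b) has_derivative (\<lambda>h. axis i h \<bullet> b)) (at 0)"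
      unfolding b inner_axis by (cases "m = i") (auto simp: axis_def intro!: derivative_eq_intros)
  qed
  from has_derivative_compose[OF this D(2)]
  have "((\<lambda>t. peval f (v + axis i t)) has_derivative (\<lambda>h. D i v * h)) (at 0)"
    by (simp only: sum_axis) (simp add: axis_def zero_vec_def[symmetric])
  then have "deriv (\<lambda>t. peval f (v + axis i t)) 0 = D i v"
    by (intro DERIV_imp_deriv) (simp add: has_field_derivative_def)
  then have Di: "D i v \<noteq> 0" using i by simp
  obtain j where j: "UNIV = {k, j, i}" "j \<noteq> k" "j \<noteq> i"
  proof -
    have "\<forall>k i::3. i \<noteq> k \<longrightarrow> (\<exists>j\<in>UNIV. (\<forall>x. x \<in> {k, j, i}) \<and> j \<noteq> k \<and> j \<noteq> i)"
      unfolding UNIV_3 forall_3 by simp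
    then show ?thesis using that v(5) by blast
  qed
  \<comment> \<open>The slice has \<open>k\<close>-th coordinate \<open>c\<close> instead of 1, so
    that it contains \<open>v\<close> itself and the derivative known at \<open>v\<close> can be
    used without rescaling.\<close>
  define c where "c = v $ k"
  define aff :: "complex \<times> complex \<Rightarrow> complex^3" where
    "aff p = (\<chi> m. if m = k then c else if m = j then fst p else snd p)" for p
  define G where "G p = peval f (aff p)" for p
  have aff_simps: "aff p $ k = c" "aff p $ j = fst p" "aff p $ i = snd p" for p
    using j v(5) by (auto simp: aff_def)
  have c: "c \<noteq> 0" using v(4) by (simp add: c_def)
  have aff_nz: "aff p \<noteq> 0" for p using aff_simps(1)[of p] c by auto
  have aff_v: "aff (v $ j, v $ i) = v"
  proof -
    have "aff (v $ j, v $ i) $ m = v $ m" for m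
      using UNIV_I[of m] aff_simps[of "(v $ j, v $ i)"] unfolding j(1) by (auto simp: c_def)
    then show ?thesis by (simp add: vec_eq_iff)
  qed
  define aff' :: "complex \<times> complex \<Rightarrow> complex^3" where
    "aff' h = (\<chi> m. if m = k then 0 else if m = j then fst h else snd h)" for h
  have daff: "(aff has_derivative aff') (at p)" for p
  proof (subst has_derivative_componentwise_within, intro ballI)
    fix b :: "complex^3" assume "b \<in> Basis"
    then obtain m c' where b: "b = axis m c'" by (auto simp: Basis_vec_def)
    show "((\<lambda>t. aff t \<bullet> b) has_derivative (\<lambda>h. aff' h \<bullet> b)) (at p)"
      unfolding b inner_axis aff_def aff'_def
      by (cases "m = k"; cases "m = j") (auto intro!: derivative_eq_intros)
  qed
  from has_derivative_compose[OF daff D(2)]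
  have "(G has_derivative (\<lambda>h. \<Sum>m\<in>UNIV. D m (aff p) * aff' h $ m)) (at p)" for p
    unfolding G_def .
  moreover have "(\<Sum>m\<in>UNIV. D m (aff p) * aff' h $ m) = D j (aff p) * fst h + D i (aff p) * snd h" for p h
    unfolding j(1) using j(2,3) v(5) by (simp add: aff'_def)
  ultimately have dG: "(G has_derivative (\<lambda>h. D j (aff p) * fst h + D i (aff p) * snd h)) (at p)" for p
    by simp
  have "continuous_on UNIV aff"
    using daff has_derivative_continuous by (intro continuous_at_imp_continuous_on) blast
  then have cD: "continuous_on UNIV (\<lambda>p. D m (aff p))" for m
    using D(1) continuous_on_compose2 by (metis subset_UNIV)
  obtain e d' h where h: "0 < e" "0 < d'" "h holomorphic_on ball (v $ j) e" "h ` ball (v $ j) e \<subseteq> ball (v $ i) d'"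
    "\<And>s z. s \<in> ball (v $ j) e \<Longrightarrow> z \<in> ball (v $ i) d' \<Longrightarrow> G (s, z) = 0 \<longleftrightarrow> z = h s"
    by (rule holomorphic_implicit_function[OF dG cD cD, of "v $ j" "v $ i"])
      (use v(3) Di in \<open>auto simp: G_def aff_v\<close>)
  have shift: "v $ j + t \<in> ball (v $ j) e" if "t \<in> ball 0 e" for t
    using that by (simp add: dist_norm)
  \<comment> \<open>The graph, with its parameter translated so that the disc is centred at
    0.\<close>
  define w where "w t = aff (v $ j + t, h (v $ j + t))" for t
  define \<gamma> where "\<gamma> t = proj_pt (w t)" for t
  have w_nz: "w t \<noteq> 0" "w t $ k = c" "w t $ j = v $ j + t" "w t $ i = h (v $ j + t)" for t
    using aff_nz aff_simps by (simp_all add: w_def)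
  have w_zero: "peval f (w t) = 0" if "t \<in> ball 0 e" for t
    using h(4,5) shift[OF that] unfolding w_def G_def[symmetric] by blast
  have "(\<lambda>t. v $ j + t) holomorphic_on ball 0 e" by (intro holomorphic_intros)
  from holomorphic_on_compose_gen[OF this h(3)] shift
  have "(\<lambda>t. h (v $ j + t)) holomorphic_on ball 0 e" by (auto simp: o_def)
  then have hol_w: "(\<lambda>t. w t $ m) holomorphic_on ball 0 e" for m
    unfolding w_def aff_def by (cases "m = k"; cases "m = j") (auto intro!: holomorphic_intros)
  have "\<gamma> t \<in> {P\<in>P2_pts. \<exists>v\<in>P. v $ k \<noteq> 0}" for t
    unfolding \<gamma>_def P2_pts_def using w_nz[of t] c by (auto simp: proj_pt_def intro!: bexI[of _ "w t"] vec.span_base)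
  moreover have "continuous_map (top_of_set (ball 0 e)) (stop P2) \<gamma>"
  proof -
    have "continuous_on (ball 0 e) (\<lambda>t. \<chi> m. w t $ m)"
      using hol_w holomorphic_on_imp_continuous_on by (intro continuous_on_vec_lambda) auto
    then have "continuous_map (top_of_set (ball 0 e)) (top_of_set (- {0})) w"
      using w_nz(1) by auto
    from continuous_map_compose[OF this continuous_map_proj_pt]
    show ?thesis unfolding \<gamma>_def by (simp add: P2_def o_def)
  qed
  moreover have "(\<lambda>t. affine_coord k (\<gamma> t) $ m) holomorphic_on ball 0 e" for m
  proof -
    have "affine_coord k (\<gamma> t) = vector [w t $ (k + 1) / c, w t $ (k + 2) / c]" for t
      unfolding \<gamma>_def using w_nz(2) c by (simp add: affine_coord_proj_pt)
    then show ?thesis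
      using exhaust_2[of m] c hol_w by (auto intro!: holomorphic_intros)
  qed
  ultimately have disc: "holo_disc P2 \<gamma> e"
    unfolding holo_disc_def using h(1) inj_on_affine_coord[of k]
    by (auto simp: P2_def intro!: bexI[of _ "({P\<in>P2_pts. \<exists>v\<in>P. v $ k \<noteq> 0}, affine_coord k)"])
  \<comment> \<open>The window of the implicit function theorem, expressed in ratios: multiplying a
    ratio by \<open>c\<close> gives the coordinate in the slice.\<close>
  define T where "T m = (if m = j then (\<lambda>x. c * x) -` ball (v $ j) e
      else if m = i then (\<lambda>x. c * x) -` ball (v $ i) d' else UNIV)" for m
  define W where "W = {Q \<in> P2_pts. coord_ratio k k Q \<noteq> 0 \<and> (\<forall>m. coord_ratio k m Q \<in> T m)}"
  define \<kappa> where "\<kappa> Q = c * coord_ratio k j Q - v $ j" for Q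
  have "open (T m)" for m
    unfolding T_def by (auto intro!: open_vimage continuous_intros)
  then have oW: "openin P2_top W" unfolding W_def by (rule openin_coord_ratio)
  have Wk: "proj_pt u \<in> W \<longleftrightarrow> u $ k \<noteq> 0 \<and> c * (u $ j / u $ k) \<in> ball (v $ j) e \<and> c * (u $ i / u $ k) \<in> ball (v $ i) d'"
    if "u \<noteq> 0" for u
  proof -
    have "(\<forall>m. coord_ratio k m (proj_pt u) \<in> T m) \<longleftrightarrow>
        coord_ratio k j (proj_pt u) \<in> T j \<and> coord_ratio k i (proj_pt u) \<in> T i"
      by (auto simp: T_def)
    then show ?thesis using that j(3) unfolding W_def by (auto simp: coord_ratio_proj_pt P2_pts_def T_def)
  qed
  have \<kappa>\<gamma>: "\<kappa> (\<gamma> t) = t" for t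
    using w_nz[of t] c by (simp add: \<kappa>_def \<gamma>_def coord_ratio_proj_pt)
  have \<kappa>: "continuous_map (subtopology P2_top W) euclidean \<kappa>"
  proof -
    have "continuous_map (subtopology P2_top W) euclidean (coord_ratio k j)"
      using continuous_map_coord_ratio by (rule continuous_map_from_subtopology_mono) (auto simp: W_def)
    moreover have "continuous_map euclidean euclidean (\<lambda>x. c * x - v $ j)"
      unfolding continuous_map_iff_continuous2 by (intro continuous_intros)
    ultimately have "continuous_map (subtopology P2_top W) euclidean ((\<lambda>x. c * x - v $ j) \<circ> coord_ratio k j)"
      by (rule continuous_map_compose)
    then show ?thesis unfolding \<kappa>_def o_def .
  qed
  have "W \<inter> curve f = \<gamma> ` ball 0 e"
  proof (intro equalityI subsetI)
    fix Q assume Q: "Q \<in> W \<inter> curve f"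
    then obtain u where u: "u \<noteq> 0" "Q = proj_pt u" "peval f u = 0" unfolding curve_def by blast
    \<comment> \<open>Scaling by this factor moves an arbitrary representative into the
      slice.\<close>
    let ?a = "c / u $ k"
    have uk: "u $ k \<noteq> 0" and s: "?a * u $ j \<in> ball (v $ j) e" and z: "?a * u $ i \<in> ball (v $ i) d'"
      using Q Wk[OF u(1)] u(2) by (auto simp: mult.commute)
    have "(?a *s u) $ m = aff (?a * u $ j, ?a * u $ i) $ m" for m
      using UNIV_I[of m] aff_simps[of "(?a * u $ j, ?a * u $ i)"] uk unfolding j(1) by auto
    then have au: "?a *s u = aff (?a * u $ j, ?a * u $ i)" unfolding vec_eq_iff by blast
    have "G (?a * u $ j, ?a * u $ i) = 0"
      unfolding G_def au[symmetric] using peval_homogeneous[OF f(1)] u(3) by simp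
    then have "?a * u $ i = h (?a * u $ j)" using h(5) s z by blast
    then have "?a *s u = w (?a * u $ j - v $ j)" using au by (simp add: w_def)
    moreover have "Q = proj_pt (?a *s u)"
      unfolding u(2) proj_pt_eq_iff[OF u(1)] using c uk by (intro exI[of _ ?a]) auto
    ultimately have "Q = \<gamma> (?a * u $ j - v $ j)" by (simp add: \<gamma>_def)
    moreover have "?a * u $ j - v $ j \<in> ball 0 e" using s by (simp add: dist_norm norm_minus_commute)
    ultimately show "Q \<in> \<gamma> ` ball 0 e" by blast
  next
    fix Q assume "Q \<in> \<gamma> ` ball 0 e"
    then obtain t where t: "t \<in> ball 0 e" "Q = \<gamma> t" by blast
    have "Q \<in> curve f" using t w_zero w_nz(1) unfolding \<gamma>_def curve_def by blast
    moreover have "h (v $ j + t) \<in> ball (v $ i) d'" using h(4) shift[OF t(1)] by blast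
    then have "Q \<in> W"
      unfolding t(2) \<gamma>_def using Wk[OF w_nz(1), of t] w_nz[of t] c shift[OF t(1)] by simp
    ultimately show "Q \<in> W \<inter> curve f" by blast
  qed
  moreover have "\<gamma> 0 = P"
  proof -
    \<comment> \<open>The base point lies on the zero set inside the window, so uniqueness puts it
      on the graph.\<close>
    have "h (v $ j) = v $ i"
      using h(1,2) h(5)[of "v $ j" "v $ i"] v(3) by (simp add: G_def aff_v)
    then show ?thesis using aff_v v(2) by (simp add: \<gamma>_def w_def)
  qed
  ultimately show ?thesis using that[OF disc _ oW _ \<kappa>] \<kappa>\<gamma> by blast
qed

section \<open>A section over the curve\<close>

text \<open>The succession starts from a Hausdorff surface homeomorphic to the plane; later
  blowing-ups leave the plane unchanged.\<close>

lemma blowing_ups_Hausdorff_P2: "blowing_ups S \<sigma> N \<Longrightarrow> Hausdorff_space P2_top"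
proof (induction rule: blowing_ups.induct)
  case (iso S \<sigma>)
  then have "homeomorphic_map (stop S) P2_top \<sigma>" "Hausdorff_space (stop S)"
    unfolding biholomorphic_def complex_surface_def by (simp_all add: P2_def)
  then show ?case using homeomorphic_Hausdorff_space homeomorphic_map_imp_homeomorphic_space by blast
qed

lemma preim_subset_strict_transform: "preim S \<sigma> (A - N) \<subseteq> strict_transform S \<sigma> N A"
  unfolding strict_transform_def by (rule closure_of_subset) (auto simp: preim_def)

lemma closedin_strict_transform: "closedin (stop S) (strict_transform S \<sigma> N A)"
  unfolding strict_transform_def by simp

text \<open>The section is \<open>\<gamma>' \<circ> \<kappa>\<close>: read off the parameter, then
  follow the lifted disc. Its value at \<open>P\<close> is a limit of points over
  \<open>curve f - N\<close>, hence lies in the strict transform.\<close>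

lemma local_section_at_smooth_point:
  assumes bu: "blowing_ups S \<sigma> N" and f: "homogeneous d f" "0 < d" and N: "N \<subseteq> curve f"
    and P: "P \<in> N" "smooth_at f P"
  obtains W s where "openin P2_top W" "P \<in> W" "W \<inter> N = {P}"
    "continuous_map (subtopology P2_top (W \<inter> curve f)) (stop S) s"
    "\<And>Q. Q \<in> W \<inter> curve f \<Longrightarrow> \<sigma> (s Q) = Q" "s P \<in> strict_transform S \<sigma> N (curve f)"
proof -
  obtain \<gamma> r W \<kappa> where \<gamma>: "holo_disc P2 \<gamma> r" "\<gamma> 0 = P" and W: "openin P2_top W" "W \<inter> curve f = \<gamma> ` ball 0 r"
    and \<kappa>: "continuous_map (subtopology P2_top W) euclidean \<kappa>" "\<And>t. t \<in> ball 0 r \<Longrightarrow> \<kappa> (\<gamma> t) = t"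
    using curve_disc_at_smooth_point[OF f P(2)] by metis
  have r: "0 < r" using \<gamma>(1) unfolding holo_disc_def by blast
  have "finite (\<kappa> ` N)" using blowing_ups_finite[OF bu] by blast
  \<comment> \<open>A parameter t with \<gamma> t in \<open>N\<close> is a value of
    \<open>\<kappa>\<close> on the finite set \<open>N\<close>; below the radius \<open>e\<close>
    only t = 0 is left.\<close>
  then obtain e where e: "0 < e" "\<forall>x\<in>\<kappa> ` N. x \<noteq> 0 \<longrightarrow> e \<le> dist 0 x"
    using finite_set_avoid[of "\<kappa> ` N" 0] by blast
  let ?r = "min r e"
  have \<gamma>N: "\<gamma> t \<notin> N" if "t \<in> ball 0 ?r" "t \<noteq> 0" for t
    using \<kappa>(2)[of t] e(2) that by force
  have "holo_disc P2 \<gamma> ?r" using holo_disc_subset[OF \<gamma>(1)] r e(1) by simp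
  then obtain \<gamma>' r' where r': "0 < r'" "r' \<le> ?r" and \<gamma>': "holo_disc S \<gamma>' r'" "\<And>t. t \<in> ball 0 r' \<Longrightarrow> \<sigma> (\<gamma>' t) = \<gamma> t"
    using blowing_ups_lift_disc[OF bu, of \<gamma> ?r] \<gamma>N by blast
  have c': "continuous_map (top_of_set (ball 0 r')) (stop S) \<gamma>'" using \<gamma>'(1) unfolding holo_disc_def by blast
  \<comment> \<open>\<open>\<kappa>\<close> cuts the neighbourhood down to the smaller radius on
    which the lift exists.\<close>
  define V where "V = {Q \<in> topspace (subtopology P2_top W). \<kappa> Q \<in> ball 0 r'}"
  have "openin (subtopology P2_top W) V"
    unfolding V_def by (rule openin_continuous_map_preimage[OF \<kappa>(1)]) simp
  then have oV: "openin P2_top V" using W(1) by (rule openin_trans_full)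
  have VW: "V \<subseteq> W" unfolding V_def by auto
  have VF: "\<exists>t. t \<in> ball 0 r' \<and> t \<in> ball 0 ?r \<and> Q = \<gamma> t \<and> \<kappa> Q = t" if Q: "Q \<in> V \<inter> curve f" for Q
  proof -
    obtain t where t: "t \<in> ball 0 r" "Q = \<gamma> t" using Q VW W(2) by blast
    then have "\<kappa> Q = t" using \<kappa>(2) by blast
    moreover have "\<kappa> Q \<in> ball 0 r'" using Q unfolding V_def by blast
    ultimately show ?thesis using t(2) r'(2) by auto
  qed
  have PV: "P \<in> V"
  proof -
    have "P \<in> W" using W(2) \<gamma>(2) r by (metis IntD1 centre_in_ball image_eqI)
    moreover have "\<kappa> P = 0" using \<kappa>(2)[of 0] r \<gamma>(2) by simp
    ultimately show ?thesis unfolding V_def using r'(1) openin_subset[OF W(1)] by auto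
  qed
  have "V \<inter> N = {P}"
  proof (intro equalityI subsetI)
    fix Q assume Q: "Q \<in> V \<inter> N"
    then obtain t where "t \<in> ball 0 ?r" "Q = \<gamma> t" using VF N by blast
    then show "Q \<in> {P}" using \<gamma>N[of t] Q \<gamma>(2) by auto
  qed (use PV P(1) in auto)
  moreover have "continuous_map (subtopology P2_top (V \<inter> curve f)) (stop S) (\<gamma>' \<circ> \<kappa>)"
  proof (rule continuous_map_compose[OF _ c'])
    have "continuous_map (subtopology P2_top (V \<inter> curve f)) euclidean \<kappa>"
      by (rule continuous_map_from_subtopology_mono[OF \<kappa>(1)]) (use VW in auto)
    then show "continuous_map (subtopology P2_top (V \<inter> curve f)) (top_of_set (ball 0 r')) \<kappa>"
      using VF by (auto simp: continuous_map_in_subtopology)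
  qed
  moreover have "\<sigma> ((\<gamma>' \<circ> \<kappa>) Q) = Q" if "Q \<in> V \<inter> curve f" for Q
    using VF[OF that] \<gamma>'(2) by auto
  moreover have "(\<gamma>' \<circ> \<kappa>) P \<in> strict_transform S \<sigma> N (curve f)"
  proof (rule ccontr)
    \<comment> \<open>Otherwise a small lifted disc would lie in the open complement of the strict
      transform, although its points with t \<noteq> 0 lie over \<open>curve f - N\<close>.\<close>
    assume "\<not> ?thesis"
    moreover have "\<kappa> P = 0" using \<kappa>(2)[of 0] r \<gamma>(2) by simp
    moreover have "\<gamma>' 0 \<in> pts S" using c' r'(1) by (auto simp: continuous_map_def)
    ultimately have "\<gamma>' 0 \<in> pts S - strict_transform S \<sigma> N (curve f)" by simp
    moreover have "openin (stop S) (pts S - strict_transform S \<sigma> N (curve f))"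
      using closedin_strict_transform by (rule openin_diff[OF openin_topspace])
    ultimately obtain r'' where r'': "0 < r''" "r'' \<le> r'"
      "\<gamma>' ` ball 0 r'' \<subseteq> pts S - strict_transform S \<sigma> N (curve f)"
      using continuous_disc_shrink[OF c' _ _ r'(1)] by metis
    define t where "t = complex_of_real (r'' / 2)"
    have t: "t \<in> ball 0 r''" "t \<noteq> 0" using r''(1) by (auto simp: t_def)
    have t': "t \<in> ball 0 r'" "t \<in> ball 0 ?r" "t \<in> ball 0 r" using t(1) r''(2) r'(2) by auto
    have "\<sigma> (\<gamma>' t) = \<gamma> t" using \<gamma>'(2) t'(1) by blast
    moreover have "\<gamma> t \<in> curve f" using W(2) t'(3) by blast
    moreover have "\<gamma> t \<notin> N" using \<gamma>N[OF t'(2) t(2)] .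
    moreover have "\<gamma>' t \<in> pts S" using c' t'(1) by (auto simp: continuous_map_def)
    ultimately have "\<gamma>' t \<in> preim S \<sigma> (curve f - N)" by (simp add: preim_def)
    then have "\<gamma>' t \<in> strict_transform S \<sigma> N (curve f)"
      by (rule subsetD[OF preim_subset_strict_transform])
    then show False using r''(3) t(1) by blast
  qed
  ultimately show ?thesis by (rule that[OF oV PV])
qed

text \<open>Away from \<open>N\<close> the section is forced to be the inverse of
  \<open>\<sigma>\<close>, so the local sections agree with it on overlaps and can be pasted. The
  left inverse property holds on a dense subset of the strict transform and extends to its closure,
  as the surface is Hausdorff.\<close>

lemma strict_transform_section:
  assumes bu: "blowing_ups S \<sigma> N" and f: "homogeneous d f" "0 < d" and N: "N \<subseteq> curve f"
    and sm: "\<And>P. P \<in> N \<Longrightarrow> smooth_at f P"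
  obtains s where
    "continuous_map (subtopology P2_top (curve f)) (subtopology (stop S) (strict_transform S \<sigma> N (curve f))) s"
    "\<And>q. q \<in> strict_transform S \<sigma> N (curve f) \<Longrightarrow> \<sigma> q \<in> curve f \<and> s (\<sigma> q) = q"
proof -
  let ?F = "curve f" and ?Ft = "strict_transform S \<sigma> N (curve f)"
  let ?Fs = "preim S \<sigma> (?F - N)" and ?X = "subtopology P2_top (curve f)"
  have FP2: "?F \<subseteq> P2_pts" using closedin_subset[OF closedin_curve[OF f(1)]] by simp
  have tX: "topspace ?X = ?F" using FP2 by auto
  have hom: "homeomorphic_map (subtopology (stop S) ?Fs) (subtopology P2_top (?F - N)) \<sigma>"
    using blowing_ups_homeomorphic_map[OF bu] by blast
  have tFs: "topspace (subtopology (stop S) ?Fs) = ?Fs" by (auto simp: preim_def)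
  obtain \<tau> where \<tau>: "homeomorphic_maps (subtopology (stop S) ?Fs) (subtopology P2_top (?F - N)) \<sigma> \<tau>"
    using hom homeomorphic_map_maps by blast
  have \<tau>c: "continuous_map (subtopology P2_top (?F - N)) (subtopology (stop S) ?Fs) \<tau>"
    using \<tau> unfolding homeomorphic_maps_def by blast
  have \<sigma>\<tau>: "\<sigma> (\<tau> Q) = Q" "\<tau> Q \<in> ?Fs" if "Q \<in> ?F - N" for Q
    using \<tau> \<tau>c that FP2 unfolding homeomorphic_maps_def by (auto simp: continuous_map_def)
  have \<tau>\<sigma>: "\<tau> (\<sigma> q) = q" if "q \<in> ?Fs" for q
    using \<tau> that tFs unfolding homeomorphic_maps_def by blast
  have "\<exists>W s. openin P2_top W \<and> W \<inter> N = {P} \<and> continuous_map (subtopology P2_top (W \<inter> ?F)) (stop S) s \<and>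
      (\<forall>Q\<in>W \<inter> ?F. \<sigma> (s Q) = Q) \<and> s P \<in> ?Ft" if "P \<in> N" for P
    using local_section_at_smooth_point[OF bu f N that sm[OF that]] by metis
  then obtain W s where W: "\<And>P. P \<in> N \<Longrightarrow> openin P2_top (W P)" "\<And>P. P \<in> N \<Longrightarrow> W P \<inter> N = {P}"
    and s: "\<And>P. P \<in> N \<Longrightarrow> continuous_map (subtopology P2_top (W P \<inter> ?F)) (stop S) (s P)"
      "\<And>P Q. P \<in> N \<Longrightarrow> Q \<in> W P \<inter> ?F \<Longrightarrow> \<sigma> (s P Q) = Q" "\<And>P. P \<in> N \<Longrightarrow> s P P \<in> ?Ft"
    by metis
  have s_pts: "s P Q \<in> pts S" if "P \<in> N" "Q \<in> W P \<inter> ?F" for P Q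
    using s(1)[OF that(1)] that(2) FP2 by (auto simp: continuous_map_def)
  have s\<tau>: "s P Q = \<tau> Q" if "P \<in> N" "Q \<in> W P \<inter> ?F" "Q \<notin> N" for P Q
    using \<tau>\<sigma>[of "s P Q"] s(2)[OF that(1,2)] s_pts[OF that(1,2)] that(2,3) by (simp add: preim_def)
  define g where "g Q = (if Q \<in> N then s Q Q else \<tau> Q)" for Q
  have clN: "closedin P2_top N"
    using blowing_ups_Hausdorff_P2[OF bu] blowing_ups_finite[OF bu] N FP2
    by (intro closedin_Hausdorff_finite) auto
  \<comment> \<open>\<open>None\<close> indexes the part of the curve away from \<open>N\<close>,
    \<open>Some P\<close> the neighbourhood of a blown-up point.\<close>
  define T where "T i = (case i of None \<Rightarrow> ?F - N | Some P \<Rightarrow> W P \<inter> ?F)" for i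
  define h where "h i = (case i of None \<Rightarrow> \<tau> | Some P \<Rightarrow> s P)" for i
  have gc: "continuous_map ?X (stop S) g"
  proof (rule pasting_lemma[where I = "insert None (Some ` N)" and T = T and f = h])
    fix i assume i: "i \<in> insert None (Some ` N)"
    show "openin ?X (T i)"
    proof (cases i)
      case None
      have "T i = (P2_pts - N) \<inter> ?F" using None FP2 by (auto simp: T_def)
      then show ?thesis
        using clN by (auto simp: openin_subtopology closedin_def)
    next
      case (Some P)
      then show ?thesis using i W(1) by (auto simp: T_def openin_subtopology)
    qed
    have "continuous_map (subtopology P2_top (?F - N)) (stop S) \<tau>"
      using \<tau>c by (simp add: continuous_map_in_subtopology)
    then show "continuous_map (subtopology ?X (T i)) (stop S) (h i)"
      using i s(1) by (auto simp: T_def h_def subtopology_subtopology Int_absorb1 Int_commute)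
  next
    fix i j Q assume i: "i \<in> insert None (Some ` N)" and j: "j \<in> insert None (Some ` N)"
      and Q: "Q \<in> topspace ?X \<inter> T i \<inter> T j"
    show "h i Q = h j Q"
    proof (cases "Q \<in> N")
      case True
      \<comment> \<open>A blown-up point lies in its own piece only, so pieces never compete
        there.\<close>
      have "k = Some Q" if k: "k \<in> insert None (Some ` N)" "Q \<in> T k" for k
      proof -
        obtain P where P: "k = Some P" "P \<in> N" using k True by (auto simp: T_def)
        then have "Q \<in> W P \<inter> N" using k(2) True by (simp add: T_def)
        then show ?thesis using W(2)[OF P(2)] P(1) by simp
      qed
      then show ?thesis using i j Q by blast
    next
      case False
      have "h k Q = \<tau> Q" if "k \<in> insert None (Some ` N)" "Q \<in> T k" for k
        using that False s\<tau> by (auto simp: T_def h_def)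
      then show ?thesis using i j Q by simp
    qed
  next
    fix Q assume Q: "Q \<in> topspace ?X"
    show "\<exists>j. j \<in> insert None (Some ` N) \<and> Q \<in> T j \<and> g Q = h j Q"
    proof (cases "Q \<in> N")
      case True
      then show ?thesis using W(2)[OF True] Q tX
        by (intro exI[of _ "Some Q"]) (auto simp: T_def h_def g_def)
    next
      case False
      then show ?thesis using Q tX by (intro exI[of _ None]) (auto simp: T_def h_def g_def)
    qed
  qed
  have "g Q \<in> ?Ft" if "Q \<in> ?F" for Q
    using that s(3) \<sigma>\<tau>(2) preim_subset_strict_transform[of S \<sigma> ?F N] by (auto simp: g_def)
  then have gFt: "continuous_map ?X (subtopology (stop S) ?Ft) g"
    using gc tX by (auto simp: continuous_map_in_subtopology)
  have \<sigma>c: "continuous_map (stop S) P2_top \<sigma>" using blowing_ups_continuous_map[OF bu] .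
  have clF: "closedin (stop S) (preim S \<sigma> ?F)"
    using closedin_continuous_map_preimage[OF \<sigma>c closedin_curve[OF f(1)]] by (simp add: preim_def)
  let ?Y = "subtopology (stop S) (preim S \<sigma> ?F)"
  \<comment> \<open>An equalizer inside the preimage of the curve, where
    \<open>g \<circ> \<sigma>\<close> is continuous. That preimage is closed, so the equalizer is
    closed in the surface.\<close>
  let ?E = "{q \<in> topspace ?Y. (g \<circ> \<sigma>) q = id q}"
  have "closedin ?Y ?E"
  proof (rule closedin_continuous_maps_eq)
    show "Hausdorff_space (stop S)"
      using blowing_ups_complex_surface[OF bu] unfolding complex_surface_def by blast
    have "continuous_map ?Y ?X \<sigma>"
      using \<sigma>c by (auto simp: continuous_map_in_subtopology continuous_map_from_subtopology preim_def)
    then show "continuous_map ?Y (stop S) (g \<circ> \<sigma>)" using gc by (rule continuous_map_compose)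
    show "continuous_map ?Y (stop S) id" by (rule continuous_map_id_subt)
  qed
  then have "closedin (stop S) ?E" using clF by (rule closedin_trans_full)
  moreover have "?Fs \<subseteq> ?E" using \<tau>\<sigma> by (auto simp: g_def preim_def)
  ultimately have "?Ft \<subseteq> ?E" unfolding strict_transform_def by (intro closure_of_minimal)
  then have "\<sigma> q \<in> ?F \<and> g (\<sigma> q) = q" if "q \<in> ?Ft" for q using that by (auto simp: preim_def)
  then show ?thesis by (rule that[OF gFt])
qed

section \<open>Linking invariants\<close>

lemma H1_group: "group (H1 X A)" and H1_comm_group: "comm_group (H1 X A)"
  by (simp_all add: H1_def)

lemma H1_map_hom: "H1_map X A Y B f \<in> hom (H1 X A) (H1 Y B)"
  unfolding H1_map_def H1_def by (rule hom_induced_hom)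

lemma H1_map_carrier: "H1_map X A Y B f c \<in> carrier (H1 Y B)"
  unfolding H1_map_def H1_def by (rule hom_induced_carrier)

lemma H1_map_compose:
  assumes "continuous_map (subtopology X A) (subtopology Y B) f"
    and "continuous_map (subtopology Y B) (subtopology Z C) g"
  shows "H1_map Y B Z C g (H1_map X A Y B f c) = H1_map X A Z C (g \<circ> f) c"
  unfolding H1_map_def using hom_induced_compose_empty[OF assms] by (metis comp_apply)

lemma continuous_map_id_subtopology_mono:
  "A \<subseteq> B \<Longrightarrow> continuous_map (subtopology X A) (subtopology X B) id"
  by (auto simp: continuous_map_in_subtopology intro: continuous_map_id_subt)

lemma H1_incl_compose:
  assumes "A \<subseteq> B" "B \<subseteq> C"
  shows "H1_incl X B C (H1_incl X A B c) = H1_incl X A C c"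
  unfolding H1_incl_def
  using H1_map_compose[OF continuous_map_id_subtopology_mono[OF assms(1)] continuous_map_id_subtopology_mono[OF assms(2)]]
  by simp

lemma H1_map_incl:
  assumes "A \<subseteq> A'" "B \<subseteq> B'" "continuous_map (subtopology X A) (subtopology Y B) f"
    and "continuous_map (subtopology X A') (subtopology Y B') f"
  shows "H1_map X A' Y B' f (H1_incl X A A' c) = H1_incl Y B B' (H1_map X A Y B f c)"
  unfolding H1_incl_def
  using H1_map_compose[OF continuous_map_id_subtopology_mono[OF assms(1)] assms(4)]
    H1_map_compose[OF assms(3) continuous_map_id_subtopology_mono[OF assms(2)]]
  by simp

lemma H1_map_homeomorphic_iso:
  assumes "homeomorphic_map (subtopology X A) (subtopology Y B) f"
  shows "H1_map X A Y B f \<in> iso (H1 X A) (H1 Y B)"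
  unfolding H1_map_def H1_def by (rule homeomorphic_map_homology_iso[OF assms])

lemma H1_map_left_inverse:
  assumes "continuous_map (subtopology X A) (subtopology Y B) f"
    and "continuous_map (subtopology Y B) (subtopology X A) g"
    and "\<And>x. x \<in> A \<Longrightarrow> g (f x) = x" and c: "c \<in> carrier (H1 X A)"
  shows "H1_map Y B X A g (H1_map X A Y B f c) = c"
proof -
  have "H1_map Y B X A g (H1_map X A Y B f c) = H1_map X A X A (g \<circ> f) c"
    by (rule H1_map_compose[OF assms(1,2)])
  also have "\<dots> = c"
    unfolding H1_map_def
    by (rule hom_induced_id_gen)
      (use continuous_map_compose[OF assms(1,2)] assms(3) c in \<open>auto simp: H1_def\<close>)
  finally show ?thesis .
qed

section \<open>Integral combinations and cosets of kernels\<close>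

lemma int_comb_carrier:
  assumes "comm_group G" "\<And>i. i < l \<Longrightarrow> g i \<in> carrier G"
  shows "int_comb G l g a \<in> carrier G"
proof -
  interpret comm_group G by fact
  show ?thesis unfolding int_comb_def using assms(2) by (intro finprod_closed) auto
qed

lemma int_comb_hom:
  assumes G: "comm_group G" and H: "comm_group H" and h: "h \<in> hom G H"
    and g: "\<And>i. i < l \<Longrightarrow> g i \<in> carrier G"
  shows "h (int_comb G l g a) = int_comb H l (\<lambda>i. h (g i)) a"
  using g
proof (induction l)
  case 0
  interpret G: comm_group G by fact
  interpret H: comm_group H by fact
  interpret group_hom G H h
    by unfold_locales (rule h)
  show ?case by (simp add: int_comb_def)
next
  case (Suc l)
  interpret G: comm_group G by fact
  interpret H: comm_group H by fact
  interpret group_hom G H h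
    by unfold_locales (rule h)
  have c: "g i [^]\<^bsub>G\<^esub> a i \<in> carrier G" "h (g i) [^]\<^bsub>H\<^esub> a i \<in> carrier H" if "i < Suc l" for i
    using Suc.prems[OF that] by simp_all
  have "int_comb G (Suc l) g a = g l [^]\<^bsub>G\<^esub> a l \<otimes>\<^bsub>G\<^esub> int_comb G l g a"
    unfolding int_comb_def lessThan_Suc using c by (intro G.finprod_insert) auto
  moreover have "int_comb H (Suc l) (\<lambda>i. h (g i)) a = h (g l) [^]\<^bsub>H\<^esub> a l \<otimes>\<^bsub>H\<^esub> int_comb H l (\<lambda>i. h (g i)) a"
    unfolding int_comb_def lessThan_Suc using c by (intro H.finprod_insert) auto
  moreover have "int_comb G l g a \<in> carrier G"
    by (rule int_comb_carrier[OF G]) (use Suc.prems in auto)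
  ultimately show ?case
    using Suc c[of l] by (simp add: hom_int_pow)
qed

lemma Z_basis_obtain:
  assumes "Z_basis G l g" "x \<in> carrier G"
  obtains a where "x = int_comb G l g a"
  using assms unfolding Z_basis_def bij_betw_def by (metis imageE)

text \<open>Evaluates \<open>the_elem\<close> in \<open>psi\<close>: the homomorphism is constant on
  a coset of its kernel.\<close>

lemma (in group_hom) image_kernel_coset:
  assumes "g \<in> carrier G"
  shows "h ` (kernel G H h #> g) = {h g}"
proof -
  have "h x = h g" if "x \<in> kernel G H h #> g" for x
    using that assms by (auto simp: r_coset_def kernel_def)
  moreover have "g \<in> kernel G H h #> g"
    using subgroup_kernel assms by (rule G.rcos_self[rotated])
  ultimately show ?thesis by blast
qed

lemma B_hat_subset: "B_hat S \<sigma> F B \<subseteq> preim S \<sigma> B"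
  unfolding B_hat_def irreducible_components_def by blast

text \<open>A component of the total transform of B that meets the strict transform of F does so
  over some P in F \<inter> B. By uniqueness it is then \<open>D_comp\<close> at P, which has been
  removed.\<close>

lemma strict_transform_disjoint_B_hat:
  assumes ad: "admissible S \<sigma> F B"
    and F: "\<And>q. q \<in> strict_transform S \<sigma> (F \<inter> B) F \<Longrightarrow> \<sigma> q \<in> F"
  shows "strict_transform S \<sigma> (F \<inter> B) F \<inter> B_hat S \<sigma> F B = {}"
proof (rule ccontr)
  assume "\<not> ?thesis"
  then obtain q Z where q: "q \<in> strict_transform S \<sigma> (F \<inter> B) F" "q \<in> Z"
    and Z: "Z \<in> irreducible_components S (preim S \<sigma> B)" "Z \<notin> D_comp S \<sigma> F B ` (F \<inter> B)"
    unfolding B_hat_def by blast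
  have "Z \<subseteq> preim S \<sigma> B" using Z(1) unfolding irreducible_components_def by blast
  then have qp: "q \<in> pts S" "\<sigma> q \<in> F \<inter> B" using q F unfolding preim_def by auto
  then have "Z \<in> meeting_comps S \<sigma> F B (\<sigma> q)"
    unfolding meeting_comps_def using Z(1) q by (auto simp: preim_def)
  moreover have "\<exists>!D. D \<in> meeting_comps S \<sigma> F B (\<sigma> q)"
    using ad qp(2) unfolding admissible_def by blast
  ultimately have "D_comp S \<sigma> F B (\<sigma> q) = Z"
    unfolding D_comp_def by (intro the1_equality)
  then show False using Z(2) qp(2) by blast
qed

theorem theorem1p9:
  fixes f b :: mpoly3 and F B :: "pt set"
    and S :: "'a csurface" and \<sigma> :: "'a \<Rightarrow> pt"
    and l :: nat and g :: "nat \<Rightarrow> pt chain set"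
  assumes "plane_curve_eqn f" and "plane_curve_eqn b" and "no_common_component f b"
    and "F = curve f" and "B = curve b"
    and "\<forall>P\<in>F \<inter> B. smooth_at f P"
    and "admissible S \<sigma> F B"
    and "Factorial_Ring.irreducible f \<or> H1 P2_top F \<cong> integer_group"
    and "linking_basis F B l g"
    and "finite (carrier (quot_group S \<sigma> F B))"
  shows "lks S \<sigma> F B l g = phi S \<sigma> F B ` curves_linking S \<sigma> F B"
proof -
  define Ft where "Ft = strict_transform S \<sigma> (F \<inter> B) F"
  let ?X = "stop S" and ?Fs = "preim S \<sigma> (F - B)"
  let ?Bc = "pts S - preim S \<sigma> B" and ?M = "pts S - B_hat S \<sigma> F B"
  obtain d where d: "homogeneous d f" "0 < d" using assms(1) unfolding plane_curve_eqn_def by blast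
  have bu: "blowing_ups S \<sigma> (F \<inter> B)" using assms(7) unfolding admissible_def by blast
  have \<sigma>c: "continuous_map ?X P2_top \<sigma>" using blowing_ups_continuous_map[OF bu] .
  have \<sigma>P2: "\<sigma> q \<in> P2_pts" if "q \<in> pts S" for q using \<sigma>c that by (auto simp: continuous_map_def)
  have FP2: "F \<subseteq> P2_pts" using closedin_subset[OF closedin_curve[OF d(1)]] assms(4) by simp
  obtain s where s: "continuous_map (subtopology P2_top F) (subtopology ?X Ft) s"
    and sF: "\<And>q. q \<in> Ft \<Longrightarrow> \<sigma> q \<in> F \<and> s (\<sigma> q) = q"
    using strict_transform_section[OF bu[unfolded assms(4)] d] assms(4,6)
    unfolding Ft_def by (metis inf_le1)
  have FsFt: "?Fs \<subseteq> Ft"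
    using preim_subset_strict_transform[of S \<sigma> F "F \<inter> B"] unfolding Ft_def by (simp add: Diff_Int)
  have FtM: "Ft \<subseteq> ?M"
    using strict_transform_disjoint_B_hat[OF assms(7)] sF closedin_subset[OF closedin_strict_transform[of S \<sigma> "F \<inter> B" F]]
    unfolding Ft_def by blast
  have BcM: "?Bc \<subseteq> ?M" using B_hat_subset by (rule Diff_mono[OF order_refl])
  have FsBc: "?Fs \<subseteq> ?Bc" unfolding preim_def by blast
  have Bc: "?Bc = preim S \<sigma> (P2_pts - B)" using \<sigma>P2 by (auto simp: preim_def)
  have hB: "homeomorphic_map (subtopology ?X ?Bc) (subtopology P2_top (P2_pts - B)) \<sigma>"
    unfolding Bc by (rule blowing_ups_homeomorphic_map[OF bu]) blast
  have hF: "homeomorphic_map (subtopology ?X ?Fs) (subtopology P2_top (F - B)) \<sigma>"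
    by (rule blowing_ups_homeomorphic_map[OF bu]) blast
  have \<sigma>Ft: "continuous_map (subtopology ?X Ft) (subtopology P2_top F) \<sigma>"
    using \<sigma>c sF by (auto simp: continuous_map_in_subtopology continuous_map_from_subtopology)

  let ?G = "H1 P2_top (P2_pts - B)" and ?K = "H1 ?X ?M"
  define \<alpha> where "\<alpha> = j_map S \<sigma> F B \<circ> sigma_B_inv S \<sigma> B"
  have iB: "sigma_B S \<sigma> B \<in> iso (H1 ?X ?Bc) ?G"
    unfolding sigma_B_def by (rule H1_map_homeomorphic_iso[OF hB])
  have iF: "H1_map ?X ?Fs P2_top (F - B) \<sigma> \<in> iso (H1 ?X ?Fs) (H1 P2_top (F - B))"
    by (rule H1_map_homeomorphic_iso[OF hF])
  have "sigma_B_inv S \<sigma> B \<in> hom ?G (H1 ?X ?Bc)"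
    unfolding sigma_B_inv_def using group.iso_set_sym[OF H1_group iB] by (rule Group.iso_imp_homomorphism)
  moreover have "j_map S \<sigma> F B \<in> hom (H1 ?X ?Bc) ?K"
    unfolding j_map_def H1_incl_def by (rule H1_map_hom)
  ultimately have "\<alpha> \<in> hom ?G ?K" unfolding \<alpha>_def by (rule hom_compose)
  then interpret \<alpha>: group_hom ?G ?K \<alpha>
    by (intro group_hom.intro group_hom_axioms.intro H1_group)
  have Ind: "Ind S \<sigma> F B = kernel ?G ?K \<alpha>" unfolding Ind_def \<alpha>_def ..
  have psi: "psi S \<sigma> F B = (\<lambda>C. the_elem (\<alpha> ` C))" unfolding psi_def \<alpha>_def ..
  \<comment> \<open>Injectivity lets \<open>phi\<close> be evaluated on any element exhibited as a
    value of \<open>psi\<close>.\<close>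
  have inj_psi: "inj_on (psi S \<sigma> F B) (carrier (quot_group S \<sigma> F B))"
    unfolding psi quot_group_def Ind by (rule \<alpha>.FactGroup_inj_on)

  let ?inc = "H1_incl P2_top (F - B) (P2_pts - B)"
  have lift: "\<exists>c'\<in>carrier (H1 ?X ?Fs). H1_map ?X ?Fs P2_top (F - B) \<sigma> c' = c"
    if "c \<in> carrier (H1 P2_top (F - B))" for c
  proof -
    have "H1_map ?X ?Fs P2_top (F - B) \<sigma> ` carrier (H1 ?X ?Fs) = carrier (H1 P2_top (F - B))"
      using iF unfolding iso_def by (simp add: bij_betw_imp_surj_on)
    then have "c \<in> H1_map ?X ?Fs P2_top (F - B) \<sigma> ` carrier (H1 ?X ?Fs)"
      using that by (simp only:)
    then obtain c' where "c = H1_map ?X ?Fs P2_top (F - B) \<sigma> c'" "c' \<in> carrier (H1 ?X ?Fs)"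
      by (rule imageE)
    then show ?thesis by (intro bexI[of _ c']) (simp only:)
  qed
  \<comment> \<open>The two routes from H1 of the preimage of \<open>F - B\<close> agree: one
    enlarges to \<open>Ft\<close> and then to the complement of \<open>B_hat\<close>, the other goes
    down to the plane and into the complement of B. \<open>\<alpha>\<close> matches them, because
    both upstairs inclusions end in the same composite.\<close>
  have phi_eq: "phi S \<sigma> F B (H1_incl ?X Ft ?M (H1_incl ?X ?Fs Ft c')) = j_tilde S \<sigma> F B c"
    if c': "c' \<in> carrier (H1 ?X ?Fs)" "H1_map ?X ?Fs P2_top (F - B) \<sigma> c' = c" for c c'
  proof -
    have "sigma_B S \<sigma> B (H1_incl ?X ?Fs ?Bc c') = ?inc c"
      unfolding sigma_B_def c'(2)[symmetric] using FsBc FP2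
      by (intro H1_map_incl homeomorphic_imp_continuous_map hB hF) auto
    moreover have "H1_incl ?X ?Fs ?Bc c' \<in> carrier (H1 ?X ?Bc)"
      unfolding H1_incl_def by (rule H1_map_carrier)
    moreover have "inj_on (sigma_B S \<sigma> B) (carrier (H1 ?X ?Bc))"
      using iB unfolding iso_def by (elim CollectE conjE bij_betw_imp_inj_on)
    ultimately have "sigma_B_inv S \<sigma> B (?inc c) = H1_incl ?X ?Fs ?Bc c'"
      unfolding sigma_B_inv_def by (intro inv_into_f_eq)
    then have \<alpha>: "\<alpha> (?inc c) = H1_incl ?X Ft ?M (H1_incl ?X ?Fs Ft c')"
      unfolding \<alpha>_def j_map_def comp_def
      by (simp only: H1_incl_compose[OF FsBc BcM] H1_incl_compose[OF FsFt FtM])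
    have inc: "?inc c \<in> carrier ?G" unfolding H1_incl_def by (rule H1_map_carrier)
    have "psi S \<sigma> F B (j_tilde S \<sigma> F B c) = \<alpha> (?inc c)"
      unfolding psi j_tilde_def Ind \<alpha>.image_kernel_coset[OF inc] by simp
    moreover have "j_tilde S \<sigma> F B c \<in> carrier (quot_group S \<sigma> F B)"
      unfolding quot_group_def j_tilde_def using inc by (auto simp: FactGroup_def RCOSETS_def)
    ultimately show ?thesis
      unfolding phi_def \<alpha>[symmetric] by (intro inv_into_f_eq[OF inj_psi])
  qed

  let ?comb = "int_comb (H1 P2_top (F - B)) l g"
  have g: "g i \<in> carrier (H1 P2_top (F - B))" if "i < l" for i
    using assms(9) that unfolding linking_basis_def by blast
  have comb: "?comb a \<in> carrier (H1 P2_top (F - B))" for a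
    by (rule int_comb_carrier[OF H1_comm_group g])
  have link: "curves_linking S \<sigma> F B = H1_incl ?X Ft ?M ` carrier (H1 ?X Ft)"
    unfolding curves_linking_def Ft_def Let_def ..
  show ?thesis
  proof (intro equalityI subsetI)
    fix K assume "K \<in> lks S \<sigma> F B l g"
    then obtain a where K: "K = j_tilde S \<sigma> F B (?comb a)" unfolding lks_def by blast
    obtain c' where c': "c' \<in> carrier (H1 ?X ?Fs)" "H1_map ?X ?Fs P2_top (F - B) \<sigma> c' = ?comb a"
      using lift[OF comb] by blast
    have "H1_incl ?X ?Fs Ft c' \<in> carrier (H1 ?X Ft)" unfolding H1_incl_def by (rule H1_map_carrier)
    then show "K \<in> phi S \<sigma> F B ` curves_linking S \<sigma> F B"
      unfolding link K phi_eq[OF c', symmetric] by blast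
  next
    fix K assume "K \<in> phi S \<sigma> F B ` curves_linking S \<sigma> F B"
    then obtain x where x: "x \<in> carrier (H1 ?X Ft)" "K = phi S \<sigma> F B (H1_incl ?X Ft ?M x)"
      unfolding link by blast
    have "Z_basis (H1 P2_top F) l (\<lambda>i. H1_incl P2_top (F - B) F (g i))"
      using assms(9) unfolding linking_basis_def by (rule conjunct2)
    \<comment> \<open>Pushed down to F, the class is a combination of the basis, and the basis
      classes come from \<open>F - B\<close>. The corresponding class \<open>c'\<close> over
      \<open>F - B\<close> is the candidate for \<open>x\<close>.\<close>
    then obtain a where "H1_map ?X Ft P2_top F \<sigma> x = int_comb (H1 P2_top F) l (\<lambda>i. H1_incl P2_top (F - B) F (g i)) a"
      using H1_map_carrier by (rule Z_basis_obtain)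
    also have "\<dots> = H1_incl P2_top (F - B) F (?comb a)"
      by (rule int_comb_hom[symmetric])
        (simp_all add: H1_comm_group g, simp add: H1_incl_def H1_map_hom)
    finally have \<sigma>x: "H1_map ?X Ft P2_top F \<sigma> x = H1_incl P2_top (F - B) F (?comb a)" .
    obtain c' where c': "c' \<in> carrier (H1 ?X ?Fs)" "H1_map ?X ?Fs P2_top (F - B) \<sigma> c' = ?comb a"
      using lift[OF comb] by blast
    have inc: "H1_incl ?X ?Fs Ft c' \<in> carrier (H1 ?X Ft)" unfolding H1_incl_def by (rule H1_map_carrier)
    have "H1_map ?X Ft P2_top F \<sigma> (H1_incl ?X ?Fs Ft c') = H1_map ?X Ft P2_top F \<sigma> x"
      unfolding \<sigma>x c'(2)[symmetric]
      by (intro H1_map_incl FsFt \<sigma>Ft homeomorphic_imp_continuous_map hF) auto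
    \<comment> \<open>The section recovers a class of \<open>Ft\<close> from its image in F, so
      \<open>x\<close> and the class coming from \<open>c'\<close> coincide.\<close>
    moreover have retract: "H1_map P2_top F ?X Ft s (H1_map ?X Ft P2_top F \<sigma> y) = y" if "y \<in> carrier (H1 ?X Ft)" for y
      by (rule H1_map_left_inverse[OF \<sigma>Ft s _ that]) (use sF in blast)
    ultimately have "x = H1_incl ?X ?Fs Ft c'" using retract[OF x(1)] retract[OF inc] by simp
    then have "K = j_tilde S \<sigma> F B (?comb a)" using x(2) phi_eq[OF c'] by simp
    then show "K \<in> lks S \<sigma> F B l g" unfolding lks_def by blast
  qed
qed

end
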